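(* For all integers $g\ge1$ and $n\ge1$, the application $\Lambda$ defines a bijection $$\Lambda:\ \biguplus_{p=0}^{g-1}\mathcal{U}^{2g-2p+1}_p(n)\longrightarrow\mathcal{D}_g(n).$$
   Context: A unicellular map with $n$ edges is a triple $\mathfrak{m}=(H,\alpha,\sigma)$ with $|H|=2n$ (half-edges), $\alpha$ a fixed-point-free involution of $H$, $\sigma$ a permutation of $H$ such that $\gamma=\alpha\sigma$ ($\gamma(h)=\alpha(\sigma(h))$) is a single cycle; cycles of $\sigma$ are vertices. Maps are rooted at a half-edge $r$, and two rooted maps are identified if a bijection of half-edge sets sends root to root and conjugates $\alpha,\sigma$ to their counterparts. The genus $g$ is given by $v=n+1-2g$ ($v$ = number of vertices). The total order $<_{\mathfrak{m}}$ on $H$ is $r<_{\mathfrak{m}}\gamma(r)<_{\mathfrak{m}}\dots<_{\mathfrak{m}}\gamma^{2n-1}(r)$; $\min_{\mathfrak{m}}(v)$ is the minimal half-edge of vertex $v$, $V(h)$ the vertex containing $h$; for vertices we write $v<_{\mathfrak{m}}w$ for $\min_{\mathfrak{m}}v<_{\mathfrak{m}}\min_{\mathfrak{m}}w$. A trisection is a half-edge $h$ with $\sigma(h)\le_{\mathfrak{m}}h$ and $\sigma(h)\ne\min_{\mathfrak{m}}V(h)$. $\mathcal{U}^k_p(n)$ is the set of rooted unicellular maps of genus $p$ with $n$ edges and a set of $k$ distinct distinguished vertices; $\mathcal{D}_g(n)$ is the set of rooted unicellular maps of genus $g$ with $n$ edges and a distinguished trisection. Gluing: given $a_1<_{\mathfrak{m}}a_2<_{\mathfrak{m}}a_3$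 in three distinct vertices $v_i=(a_i,h_i^1,\dots,h_i^{m_i})$, the glued map is $(H,\alpha,\bar\sigma)$ (same root), $\bar\sigma$ obtained from $\sigma$ by replacing $v_1,v_2,v_3$ with the cycle $(a_1,h_2^1,\dots,h_2^{m_2},a_2,h_3^1,\dots,h_3^{m_3},a_3,h_1^1,\dots,h_1^{m_1})$. $\Phi$: for three distinct vertices $v_1<_{\mathfrak{m}}v_2<_{\mathfrak{m}}v_3$ with $a_i=\min_{\mathfrak{m}}v_i$, $\Phi(\mathfrak{m},v_1,v_2,v_3)=(\bar{\mathfrak{m}},\tau)$ where $\bar{\mathfrak{m}}=(H,\alpha,\bar\sigma)$ is the gluing at $a_1,a_2,a_3$ and $\tau=\bar\sigma^{-1}(a_3)$. $\Psi$: for vertices $v_1,v_2$ and a trisection $\tau$ of $\mathfrak{m}$ with $v_1<_{\mathfrak{m}}v_2<_{\mathfrak{m}}V(\tau)$, $\Psi(\mathfrak{m},v_1,v_2,\tau)=(\bar{\mathfrak{m}},\tau)$ where $\bar{\mathfrak{m}}$ is the gluing at $\min_{\mathfrak{m}}v_1,\min_{\mathfrak{m}}v_2,\sigma(\tau)$. $\Lambda$: given $q\ge1$ and $(\mathfrak{m},v_1,\dots,v_{2q+1})\in\mathcal{U}^{2q+1}_p(n)$ with vertices numbered so that $v_1<_{\mathfrak{m}}v_2<_{\mathfrak{m}}\dots<_{\mathfrak{m}}v_{2q+1}$: (i) let $(\mathfrak{m}_1,\tau)=\Phi(\mathfrak{m},v_{2q-1},v_{2q},v_{2q+1})$; (ii)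 for $i=1,\dots,q-1$, let $(\mathfrak{m}_{i+1},\tau)=\Psi(\mathfrak{m}_i,v_{2q-2i-1},v_{2q-2i},\tau)$. Then $\Lambda(\mathfrak{m},v_1,\dots,v_{2q+1})=(\mathfrak{m}_q,\tau)$. *)

theory Defs
  imports "HOL-Combinatorics.Orbits" "HOL-Combinatorics.Permutations"
begin

record 'h rooted_map =
  half_edges :: "'h set"
  edge_inv :: "'h \<Rightarrow> 'h"    (* \<alpha> *)
  vertex_perm :: "'h \<Rightarrow> 'h" (* \<sigma> *)
  root_he :: 'h

definition face_perm :: "'h rooted_map \<Rightarrow> 'h \<Rightarrow> 'h" where
  "face_perm m = edge_inv m \<circ> vertex_perm m"

definition unicellular :: "nat \<Rightarrow> 'h rooted_map \<Rightarrow> bool" where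
  "unicellular n m \<longleftrightarrow>
     finite (half_edges m) \<and> card (half_edges m) = 2 * n \<and>
     edge_inv m permutes half_edges m \<and>
     (\<forall>h\<in>half_edges m. edge_inv m h \<noteq> h \<and> edge_inv m (edge_inv m h) = h) \<and>
     vertex_perm m permutes half_edges m \<and>
     cyclic_on (face_perm m) (half_edges m) \<and>
     root_he m \<in> half_edges m"

text \<open>A vertex, i.e. a cycle of \<open>\<sigma>\<close>, is represented by its set of half-edges.\<close>

definition vertex_of :: "'h rooted_map \<Rightarrow> 'h \<Rightarrow> 'h set" where
  "vertex_of m h = orbit (vertex_perm m) h"

definition vertices :: "'h rooted_map \<Rightarrow> 'h set set" where
  "vertices m = vertex_of m ` half_edges m"

definition has_genus :: "nat \<Rightarrow> nat \<Rightarrow> 'h rooted_map \<Rightarrow> bool" where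
  "has_genus n g m \<longleftrightarrow> int (card (vertices m)) = int n + 1 - 2 * int g"

definition he_less :: "'h rooted_map \<Rightarrow> 'h \<Rightarrow> 'h \<Rightarrow> bool" where
  "he_less m h h' \<longleftrightarrow>
     (\<exists>i j. i < j \<and> j < card (half_edges m) \<and>
        h = (face_perm m ^^ i) (root_he m) \<and> h' = (face_perm m ^^ j) (root_he m))"

definition he_le :: "'h rooted_map \<Rightarrow> 'h \<Rightarrow> 'h \<Rightarrow> bool" where
  "he_le m h h' \<longleftrightarrow> he_less m h h' \<or> h = h'"

definition vmin :: "'h rooted_map \<Rightarrow> 'h set \<Rightarrow> 'h" where
  "vmin m v = (THE h. h \<in> v \<and> (\<forall>h'\<in>v. he_le m h h'))"

definition vertex_less :: "'h rooted_map \<Rightarrow> 'h set \<Rightarrow> 'h set \<Rightarrow> bool" where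
  "vertex_less m v w \<longleftrightarrow> he_less m (vmin m v) (vmin m w)"

definition trisection :: "'h rooted_map \<Rightarrow> 'h \<Rightarrow> bool" where
  "trisection m h \<longleftrightarrow>
     h \<in> half_edges m \<and> he_le m (vertex_perm m h) h \<and>
     vertex_perm m h \<noteq> vmin m (vertex_of m h)"

definition rooted_map_iso :: "('h \<Rightarrow> 'h) \<Rightarrow> 'h rooted_map \<Rightarrow> 'h rooted_map \<Rightarrow> bool" where
  "rooted_map_iso f m m' \<longleftrightarrow>
     bij_betw f (half_edges m) (half_edges m') \<and>
     f (root_he m) = root_he m' \<and>
     (\<forall>h\<in>half_edges m. f (edge_inv m h) = edge_inv m' (f h)) \<and>
     (\<forall>h\<in>half_edges m. f (vertex_perm m h) = vertex_perm m' (f h))"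

text \<open>Concrete (labelled) maps with distinguished vertices, respectively with a distinguished
  trisection; \<open>U\<close> and \<open>D\<close> below consist of their isomorphism classes.\<close>

definition U_rep :: "nat \<Rightarrow> nat \<Rightarrow> nat \<Rightarrow> ('h rooted_map \<times> 'h set set) set" where
  "U_rep k p n =
     {(m, S). unicellular n m \<and> has_genus n p m \<and> S \<subseteq> vertices m \<and> card S = k}"

definition D_rep :: "nat \<Rightarrow> nat \<Rightarrow> ('h rooted_map \<times> 'h) set" where
  "D_rep g n = {(m, \<tau>). unicellular n m \<and> has_genus n g m \<and> trisection m \<tau>}"

definition U_iso ::
    "nat \<Rightarrow> (('h rooted_map \<times> 'h set set) \<times> ('h rooted_map \<times> 'h set set)) set" where
  "U_iso n =
     {((m, S), (m', S')). unicellular n m \<and> S \<subseteq> vertices m \<and>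
        unicellular n m' \<and> S' \<subseteq> vertices m' \<and>
        (\<exists>f. rooted_map_iso f m m' \<and> (\<lambda>v. f ` v) ` S = S')}"

definition D_iso :: "nat \<Rightarrow> (('h rooted_map \<times> 'h) \<times> ('h rooted_map \<times> 'h)) set" where
  "D_iso n =
     {((m, \<tau>), (m', \<tau>')). unicellular n m \<and> \<tau> \<in> half_edges m \<and>
        unicellular n m' \<and> \<tau>' \<in> half_edges m' \<and>
        (\<exists>f. rooted_map_iso f m m' \<and> f \<tau> = \<tau>')}"

definition U :: "nat \<Rightarrow> nat \<Rightarrow> nat \<Rightarrow> ('h rooted_map \<times> 'h set set) set set" where
  "U k p n = U_rep k p n // U_iso n"

definition D :: "nat \<Rightarrow> nat \<Rightarrow> ('h rooted_map \<times> 'h) set set" where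
  "D g n = D_rep g n // D_iso n"

text \<open>Replacing the cycles \<open>(a\<^sub>i, h\<^sub>i\<^sup>1, \<dots>)\<close>, \<open>i = 1, 2, 3\<close>, of \<open>\<sigma>\<close> by the cycle
  \<open>(a\<^sub>1, h\<^sub>2\<^sup>1, \<dots>, a\<^sub>2, h\<^sub>3\<^sup>1, \<dots>, a\<^sub>3, h\<^sub>1\<^sup>1, \<dots>)\<close> changes only the images of the \<open>a\<^sub>i\<close>, since
  \<open>h\<^sub>i\<^sup>1 = \<sigma> a\<^sub>i\<close>; a vertex of degree one, where \<open>\<sigma> a\<^sub>i = a\<^sub>i\<close>, is covered as well.\<close>

definition glue :: "'h rooted_map \<Rightarrow> 'h \<Rightarrow> 'h \<Rightarrow> 'h \<Rightarrow> 'h rooted_map" where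
  "glue m a1 a2 a3 = m\<lparr>vertex_perm :=
     (vertex_perm m)(a1 := vertex_perm m a2, a2 := vertex_perm m a3, a3 := vertex_perm m a1)\<rparr>"

definition Phi :: "'h rooted_map \<Rightarrow> 'h set \<Rightarrow> 'h set \<Rightarrow> 'h set \<Rightarrow> 'h rooted_map \<times> 'h" where
  "Phi m v1 v2 v3 =
     (let m' = glue m (vmin m v1) (vmin m v2) (vmin m v3)
      in (m', inv (vertex_perm m') (vmin m v3)))"

definition Psi :: "'h rooted_map \<Rightarrow> 'h set \<Rightarrow> 'h set \<Rightarrow> 'h \<Rightarrow> 'h rooted_map \<times> 'h" where
  "Psi m v1 v2 \<tau> = (glue m (vmin m v1) (vmin m v2) (vertex_perm m \<tau>), \<tau>)"

definition sorted_vertices :: "'h rooted_map \<Rightarrow> 'h set set \<Rightarrow> 'h set list" where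
  "sorted_vertices m S = (THE vs. sorted_wrt (vertex_less m) vs \<and> set vs = S)"

text \<open>\<open>Lambda_seq m v q i\<close> is the pair \<open>(m\<^sub>i\<^sub>+\<^sub>1, \<tau>)\<close>; the family \<open>v\<close> is indexed from 1.\<close>

primrec Lambda_seq ::
    "'h rooted_map \<Rightarrow> (nat \<Rightarrow> 'h set) \<Rightarrow> nat \<Rightarrow> nat \<Rightarrow> 'h rooted_map \<times> 'h" where
  "Lambda_seq m v q 0 = Phi m (v (2 * q - 1)) (v (2 * q)) (v (2 * q + 1))"
| "Lambda_seq m v q (Suc i) =
     (case Lambda_seq m v q i of
        (m', \<tau>) \<Rightarrow> Psi m' (v (2 * q - 2 * Suc i - 1)) (v (2 * q - 2 * Suc i)) \<tau>)"

definition Lambda_rep :: "'h rooted_map \<times> 'h set set \<Rightarrow> 'h rooted_map \<times> 'h" where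
  "Lambda_rep = (\<lambda>(m, S).
     let q = (card S - 1) div 2
     in Lambda_seq m (\<lambda>j. sorted_vertices m S ! (j - 1)) q (q - 1))"

definition Lambda :: "nat \<Rightarrow> ('h rooted_map \<times> 'h set set) set \<Rightarrow> ('h rooted_map \<times> 'h) set" where
  "Lambda n X = (\<Union>x\<in>X. D_iso n `` {Lambda_rep x})"

end

theory Submission
  imports Defs
begin

text \<open>
  Encode a trisection \<open>\<tau>\<close> by \<open>b = \<sigma>(\<tau>)\<close>. Gluing at \<open>a\<^sub>1 < a\<^sub>2 < b\<close> multiplies \<open>\<sigma>\<close> by a 3-cycle
  and exchanges the intervals \<open>(a\<^sub>1, a\<^sub>2]\<close> and \<open>(a\<^sub>2, b]\<close> of the face order; gluing once more at
  \<open>a\<^sub>1, b, a\<^sub>2\<close> undoes it. If \<open>a\<^sub>1\<close> and \<open>a\<^sub>2\<close> are minima of vertices below the vertex of \<open>b\<close>,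
  both are recovered from the glued map: \<open>a\<^sub>1\<close> is the minimum of the vertex of \<open>b\<close>, and \<open>a\<^sub>2\<close> is the
  smallest half-edge exceeding \<open>b\<close> in the part of that vertex running from \<open>a\<^sub>1\<close> to \<open>b\<close>. So as long as
  \<open>b\<close> is not the minimum of its vertex there is exactly one way to slice. Slicing creates two
  vertices, and a unicellular map has at most \<open>n + 1\<close> of them, so it ends in a map where \<open>b\<close> is
  the minimum of its vertex; the vertices created on the way are the distinguished ones. All
  this is invariant under isomorphism of rooted maps.
\<close>

section \<open>Merging and splitting orbits by a transposition\<close>

text \<open>The interval between \<open>a\<^sub>1\<close> and \<open>a\<^sub>2\<close>, which gluing
  places between \<open>b\<close> and \<open>a\<^sub>2\<close>, contains no half-edge of the two
  upper vertices, since their minima are at or after \<open>a\<^sub>2\<close>; this is why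
  \<open>a\<^sub>2\<close> comes first among the candidates after \<open>b\<close>. Conversely, a
  candidate exists because of the trisection condition: the \<sigma>-predecessor of \<open>b\<close>
  lies in the part considered and comes after \<open>b\<close> in the face order. That part is the
  cycle of \<open>b\<close> in the permutation half-way between two transpositions that compose to
  the 3-cycle. The obstacle is that the bijection is between isomorphism classes and that the number
  of gluings is not visible in the result. Rooted isomorphisms preserve positions in the face order,
  so uniqueness of slicing is proved in the form that an isomorphism of glued maps which respects
  \<open>b\<close> is itself an isomorphism of the sliced maps. Whether \<open>b\<close> is the
  minimum of its vertex tells when to stop, so maps of different genera are compared as
  well.\<close>

lemma permutation_comp_transpose:
  "permutation s \<Longrightarrow> permutation (s \<circ> transpose x y)"
  by (simp add: permutation_compose permutation_swap_id)

lemma orbit_eq_of_mem: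
  assumes "permutation s" "y \<in> orbit s x"
  shows "orbit s y = orbit s x"
  using orbit_cyclic_eq3[OF cyclic_on_orbit'[OF assms(1)] assms(2)] .

text \<open>Right composition with the transposition swaps the images of \<open>x\<close> and
  \<open>y\<close>: from \<open>x\<close> the walk first runs through the old cycle of
  \<open>y\<close> and, on reaching \<open>y\<close>, continues through the old cycle of
  \<open>x\<close>.\<close>

lemma orbit_comp_transpose_merge:
  assumes s: "permutation s" and y: "y \<notin> orbit s x"
  shows "orbit (s \<circ> transpose x y) x = orbit s x \<union> orbit s y"
proof -
  let ?t = "s \<circ> transpose x y"
  \<comment> \<open>From \<open>u\<close> the walk enters the cycle of \<open>v\<close> at
    \<open>s v\<close>. Inside that cycle only \<open>v\<close> has a new image, and its old image
    \<open>s v\<close> has been visited already.\<close>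
  have incl: "orbit s v \<subseteq> orbit (s \<circ> transpose u v) u" if uv: "u \<notin> orbit s v" for u v
  proof
    let ?r = "s \<circ> transpose u v"
    have base: "s v \<in> orbit ?r u"
      using orbit.base[of ?r u] by simp
    fix z assume "z \<in> orbit s v"
    then show "z \<in> orbit ?r u"
    proof induction
      case base
      show ?case by (fact base)
    next
      case (step z)
      then have "z \<noteq> u" using uv by auto
      then show ?case
        using base orbit.step[OF step.IH] by (cases "z = v") (simp_all add: comp_def)
    qed
  qed
  have x: "x \<notin> orbit s y"
    using y s by (metis orbit_swap permutation_self_in_orbit)
  have "y \<in> orbit ?t x"
    using incl[OF x] permutation_self_in_orbit[OF s] by blast
  then have "orbit ?t y = orbit ?t x"
    by (intro orbit_eq_of_mem permutation_comp_transpose s)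
  moreover have "orbit s x \<subseteq> orbit ?t y"
    using incl[OF y] by (simp add: transpose_commute)
  moreover have "orbit ?t x \<subseteq> orbit s x \<union> orbit s y"
  proof
    fix z assume "z \<in> orbit ?t x"
    then show "z \<in> orbit s x \<union> orbit s y"
    proof induction
      case base
      show ?case by (simp add: orbit.base)
    next
      case (step z)
      then show ?case
        by (cases "z = x \<or> z = y") (auto intro: orbit.intros)
    qed
  qed
  ultimately show ?thesis using incl[OF x] by blast
qed

lemma orbit_comp_transpose_other:
  assumes s: "permutation s" and "x \<notin> orbit s z" "y \<notin> orbit s z"
  shows "orbit (s \<circ> transpose x y) z = orbit s z"
proof (rule orbit_cong)
  show "z \<in> orbit s z" using s by (rule permutation_self_in_orbit)
  show "(s \<circ> transpose x y) u = s u" if "u \<in> orbit s z" for u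
    using that assms by (cases "u = x \<or> u = y") auto
qed

text \<open>The new cycle of \<open>x\<close> starts at \<open>s y\<close> and follows the old one
  up to \<open>x\<close>, so it closes before it meets \<open>y\<close>. The decomposition is then
  the merging lemma applied to the new permutation.\<close>

lemma orbit_comp_transpose_split:
  assumes s: "permutation s" and y: "y \<in> orbit s x" and ne: "x \<noteq> y"
  shows "y \<notin> orbit (s \<circ> transpose x y) x"
    and "orbit s x = orbit (s \<circ> transpose x y) x \<union> orbit (s \<circ> transpose x y) y"
proof -
  let ?t = "s \<circ> transpose x y"
  have x: "x \<in> orbit s y"
    using y s by (metis orbit_swap permutation_self_in_orbit)
  define k where "k = funpow_dist1 s y x"
  have k: "k > 0" "(s ^^ k) y = x" and least: "\<And>i. 0 < i \<Longrightarrow> i < k \<Longrightarrow> (s ^^ i) y \<noteq> x"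
    unfolding k_def by (simp, rule funpow_dist1_prop[OF x], rule funpow_dist1_least)
  have not_y: "(s ^^ i) y \<noteq> y" if "0 < i" "i \<le> k" for i
  proof
    assume *: "(s ^^ i) y = y"
    with k(2) ne that have "i < k" by (metis le_neq_implies_less)
    moreover have "(s ^^ (k - i)) y = x"
      using * k(2) that by (metis funpow_add comp_apply le_add_diff_inverse2)
    ultimately show False using least[of "k - i"] that by auto
  qed
  have pw: "0 < i \<Longrightarrow> i \<le> k \<Longrightarrow> (?t ^^ i) x = (s ^^ i) y" for i
  proof (induction i)
    case (Suc i)
    show ?case
    proof (cases "i = 0")
      case False
      then have "(?t ^^ i) x = (s ^^ i) y" using Suc.prems by (intro Suc.IH) auto
      moreover have "(s ^^ i) y \<noteq> x" "(s ^^ i) y \<noteq> y" using False Suc least not_y by auto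
      ultimately show ?thesis by (simp add: comp_def)
    qed simp
  qed simp
  have "(?t ^^ k) x = x" using pw k by simp
  then have orb: "orbit ?t x = {(?t ^^ i) x | i. i < k}"
    using k(1) by (rule orbit_altdef_bounded)
  show nin: "y \<notin> orbit ?t x"
  proof
    assume "y \<in> orbit ?t x"
    then obtain i where "i < k" "(?t ^^ i) x = y" using orb by auto
    then show False using pw[of i] not_y[of i] ne by (cases "i = 0") auto
  qed
  have "?t \<circ> transpose x y = s" by (simp add: fun_eq_iff)
  with orbit_comp_transpose_merge[OF permutation_comp_transpose[OF s] nin]
  show "orbit s x = orbit ?t x \<union> orbit ?t y" by simp
qed

section \<open>The face order\<close>

definition pos :: "'h rooted_map \<Rightarrow> 'h \<Rightarrow> nat" where
  "pos m h = funpow_dist (face_perm m) (root_he m) h"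

lemma unicellular_finite: "unicellular n m \<Longrightarrow> finite (half_edges m)"
  and unicellular_card: "unicellular n m \<Longrightarrow> card (half_edges m) = 2 * n"
  and unicellular_root: "unicellular n m \<Longrightarrow> root_he m \<in> half_edges m"
  and unicellular_vertex_permutes: "unicellular n m \<Longrightarrow> vertex_perm m permutes half_edges m"
  and unicellular_edge_permutes: "unicellular n m \<Longrightarrow> edge_inv m permutes half_edges m"
  and unicellular_cyclic: "unicellular n m \<Longrightarrow> cyclic_on (face_perm m) (half_edges m)"
  by (auto simp: unicellular_def)

lemma unicellular_face_permutes: "unicellular n m \<Longrightarrow> face_perm m permutes half_edges m"
  unfolding face_perm_def
  by (intro permutes_compose unicellular_vertex_permutes unicellular_edge_permutes)

lemma unicellular_vertex_permutation: "unicellular n m \<Longrightarrow> permutation (vertex_perm m)"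
  using unicellular_vertex_permutes unicellular_finite unfolding permutation_permutes by blast

lemma unicellular_orbit_root:
  "unicellular n m \<Longrightarrow> orbit (face_perm m) (root_he m) = half_edges m"
  by (intro orbit_cyclic_eq3 unicellular_cyclic unicellular_root)

text \<open>As \<gamma> is a single cycle of length \<open>2 * n\<close>, \<open>pos\<close> inverts
  the map from \<open>i < 2 * n\<close> to the i-th iterate of the root. The guard in the fourth
  claim excludes the last half-edge, which \<gamma> sends back to the root.\<close>

lemma pos_numbering:
  assumes m: "unicellular n m"
  shows "inj_on (pos m) (half_edges m)"
    and "pos m (root_he m) = 0"
    and "h \<in> half_edges m \<Longrightarrow> pos m h < 2 * n"
    and "h \<in> half_edges m \<Longrightarrow> Suc (pos m h) < 2 * n \<Longrightarrow> pos m (face_perm m h) = Suc (pos m h)"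
    and "i < 2 * n \<Longrightarrow> pos m ((face_perm m ^^ i) (root_he m)) = i"
    and "h \<in> half_edges m \<Longrightarrow> (face_perm m ^^ pos m h) (root_he m) = h"
proof -
  let ?H = "half_edges m" and ?f = "face_perm m" and ?r = "root_he m"
  define N where "N = funpow_dist1 ?f ?r ?r"
  have orb: "orbit ?f ?r = ?H" using m by (rule unicellular_orbit_root)
  have rr: "?r \<in> orbit ?f ?r" using orb m unicellular_root by blast
  have H: "?H = (\<lambda>i. (?f ^^ i) ?r) ` {0..<N}"
    using orbit_conv_funpow_dist1[OF rr] orb by (simp add: N_def)
  have inj: "inj_on (\<lambda>i. (?f ^^ i) ?r) {0..<N}"
    unfolding N_def using rr by (rule inj_on_funpow_dist1)
  have N: "N = 2 * n"
    using card_image[OF inj] H unicellular_card[OF m] by simp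
  show inv_pw: "(?f ^^ pos m h) ?r = h" if "h \<in> ?H" for h
    unfolding pos_def by (rule funpow_dist_prop) (simp add: orb that)
  show pw: "pos m ((?f ^^ i) ?r) = i" if "i < 2 * n" for i
  proof -
    have "pos m ((?f ^^ i) ?r) \<le> i"
      unfolding pos_def funpow_dist_def by (rule Least_le) simp
    moreover have "(?f ^^ i) ?r \<in> ?H" using H that N by auto
    then have "(?f ^^ pos m ((?f ^^ i) ?r)) ?r = (?f ^^ i) ?r" by (rule inv_pw)
    ultimately show ?thesis
      using inj that N by (auto dest: inj_onD)
  qed
  show "inj_on (pos m) ?H" by (rule inj_on_inverseI[where g = "\<lambda>i. (?f ^^ i) ?r"]) (rule inv_pw)
  show "pos m ?r = 0" by (simp add: pos_def funpow_dist_0)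
  show lt: "pos m h < 2 * n" if "h \<in> ?H" for h
    using that H pw N by auto
  show "pos m (?f h) = Suc (pos m h)" if "h \<in> ?H" "Suc (pos m h) < 2 * n" for h
    using pw[OF that(2)] inv_pw[OF that(1)] by simp
qed

lemma pos_less_imp_Suc:
  assumes "unicellular n m" "x \<in> half_edges m" "y \<in> half_edges m" "pos m x < pos m y"
  shows "pos m (face_perm m x) = Suc (pos m x)"
  using assms pos_numbering(3)[OF assms(1,3)] by (intro pos_numbering(4)) auto

lemma pos_eq_iff:
  "unicellular n m \<Longrightarrow> x \<in> half_edges m \<Longrightarrow> y \<in> half_edges m \<Longrightarrow> pos m x = pos m y \<longleftrightarrow> x = y"
  using pos_numbering(1) by (metis inj_onD)

lemma he_less_iff_pos:
  assumes m: "unicellular n m"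
  shows "he_less m x y \<longleftrightarrow> x \<in> half_edges m \<and> y \<in> half_edges m \<and> pos m x < pos m y"
proof
  assume "he_less m x y"
  then obtain i j where "i < j" "j < 2 * n"
    "x = (face_perm m ^^ i) (root_he m)" "y = (face_perm m ^^ j) (root_he m)"
    unfolding he_less_def unicellular_card[OF m] by auto
  then show "x \<in> half_edges m \<and> y \<in> half_edges m \<and> pos m x < pos m y"
    using m cyclic_on_funpow_in[OF unicellular_cyclic[OF m] unicellular_root[OF m]]
    by (simp add: pos_numbering(5))
next
  assume "x \<in> half_edges m \<and> y \<in> half_edges m \<and> pos m x < pos m y"
  then show "he_less m x y"
    unfolding he_less_def unicellular_card[OF m] using pos_numbering(3,6)[OF m] by metis
qed

lemma he_le_iff_pos:
  assumes "unicellular n m" "x \<in> half_edges m" "y \<in> half_edges m"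
  shows "he_le m x y \<longleftrightarrow> pos m x \<le> pos m y"
  using assms by (auto simp: he_le_def he_less_iff_pos pos_eq_iff le_less)

text \<open>Iterating \<gamma> from the root raises \<open>P\<close> by one each time, so
  injectivity identifies each \<open>h\<close> with the iterate of index \<open>P h\<close>, and all
  half-edges lie on one face. An explicit formula for the face order thus proves unicellularity and
  computes \<open>pos\<close> at the same time.\<close>

lemma cyclic_on_and_pos_of_numbering:
  assumes perm: "face_perm m permutes half_edges m" and fin: "finite (half_edges m)"
    and root: "root_he m \<in> half_edges m"
    and inj: "inj_on P (half_edges m)"
    and less: "\<And>h. h \<in> half_edges m \<Longrightarrow> P h < card (half_edges m)"
    and P0: "P (root_he m) = 0"
    and PS: "\<And>h. h \<in> half_edges m \<Longrightarrow> Suc (P h) < card (half_edges m) \<Longrightarrow> P (face_perm m h) = Suc (P h)"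
  shows "cyclic_on (face_perm m) (half_edges m)"
    and "h \<in> half_edges m \<Longrightarrow> pos m h = P h"
proof -
  let ?H = "half_edges m" and ?f = "face_perm m" and ?r = "root_he m"
  have in_H: "(?f ^^ i) ?r \<in> ?H" for i
    by (induction i) (use root perm in \<open>auto simp: permutes_in_image\<close>)
  have pw: "i < card ?H \<Longrightarrow> P ((?f ^^ i) ?r) = i" for i
    by (induction i) (use PS in_H P0 in auto)
  have inv_pw: "(?f ^^ P h) ?r = h" if "h \<in> ?H" for h
    using inj_onD[OF inj pw[OF less[OF that]] in_H that] .
  have perm': "permutation ?f" using perm fin by (auto simp: permutation_permutes)
  have orb: "orbit ?f ?r = ?H"
    unfolding orbit_altdef_permutation[OF perm'] using in_H inv_pw by (auto, metis)
  then show "cyclic_on ?f ?H" using root by (auto simp: cyclic_on_def)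
  show "pos m h = P h" if h: "h \<in> ?H" for h
  proof -
    have "(?f ^^ pos m h) ?r = h"
      unfolding pos_def by (rule funpow_dist_prop) (simp add: orb h)
    moreover have "pos m h \<le> P h"
      unfolding pos_def funpow_dist_def by (rule Least_le) (rule inv_pw[OF h])
    ultimately show ?thesis
      using pw[of "pos m h"] less[OF h] by simp
  qed
qed

text \<open>Positions after gluing at \<open>a < b < c\<close>. The new \<gamma> continues from
  \<open>a\<close> with the old successor of \<open>b\<close>, so the block after \<open>a\<close>
  up to \<open>b\<close> and the block after \<open>b\<close> up to \<open>c\<close> change places,
  each shifted by the length of the other.\<close>

definition glue_pos :: "'h rooted_map \<Rightarrow> 'h \<Rightarrow> 'h \<Rightarrow> 'h \<Rightarrow> 'h \<Rightarrow> nat" where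
  "glue_pos m a b c h =
    (if pos m h \<le> pos m a then pos m h
     else if pos m h \<le> pos m b then pos m h + (pos m c - pos m b)
     else if pos m h \<le> pos m c then pos m h - (pos m b - pos m a)
     else pos m h)"

lemma glue_simps [simp]:
  "half_edges (glue m a b c) = half_edges m"
  "edge_inv (glue m a b c) = edge_inv m"
  "root_he (glue m a b c) = root_he m"
  "vertex_perm (glue m a b c) = (vertex_perm m)
     (a := vertex_perm m b, b := vertex_perm m c, c := vertex_perm m a)"
  by (auto simp: glue_def)

text \<open>The factorisation that follows gluing: the vertices of \<open>b\<close> and
  \<open>c\<close> merge first, then the result merges with the vertex of \<open>a\<close>.\<close>

lemma glue_vertex_perm_transposes:
  assumes "a \<noteq> b" "b \<noteq> c" "a \<noteq> c"
  shows "vertex_perm (glue m a b c) = vertex_perm m \<circ> transpose b c \<circ> transpose a c"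
  using assms by (auto simp: fun_eq_iff transpose_def)

text \<open>The same 3-cycle in the order suited to slicing: \<open>a\<close> is separated from
  \<open>b\<close> first, then \<open>c\<close> from \<open>b\<close>.\<close>

lemma glue_vertex_perm_transposes':
  assumes "a \<noteq> b" "b \<noteq> c" "a \<noteq> c"
  shows "vertex_perm (glue m a b c) = vertex_perm m \<circ> transpose a b \<circ> transpose b c"
  using assms by (auto simp: fun_eq_iff transpose_def)

lemma glue_face_perm:
  assumes "a \<noteq> b" "b \<noteq> c" "a \<noteq> c"
  shows "face_perm (glue m a b c) = (face_perm m)
     (a := face_perm m b, b := face_perm m c, c := face_perm m a)"
  using assms by (auto simp: face_perm_def fun_eq_iff)

lemma glue_glue:
  assumes "a \<noteq> b" "b \<noteq> c" "a \<noteq> c"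
  shows "glue (glue m a b c) a c b = m"
  using assms by (simp add: glue_def fun_upd_twist)

text \<open>\<open>glue_pos\<close> is fed into the numbering criterion. Away from \<open>a\<close>,
  \<open>b\<close>, \<open>c\<close> the face permutation is unchanged and blocks are shifted as a
  whole, so only three seams need a check of their own.\<close>

lemma glue_unicellular:
  assumes m: "unicellular n m"
    and a: "a \<in> half_edges m" and b: "b \<in> half_edges m" and c: "c \<in> half_edges m"
    and ab: "pos m a < pos m b" and bc: "pos m b < pos m c"
  shows "unicellular n (glue m a b c)"
    and "h \<in> half_edges m \<Longrightarrow> pos (glue m a b c) h = glue_pos m a b c h"
proof -
  let ?m = "glue m a b c" and ?H = "half_edges m"
  have ne: "a \<noteq> b" "b \<noteq> c" "a \<noteq> c" using ab bc by auto
  have perm: "vertex_perm ?m permutes ?H"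
    unfolding glue_vertex_perm_transposes[OF ne]
    by (intro permutes_compose permutes_swap_id unicellular_vertex_permutes[OF m] a b c)
  have face: "face_perm ?m permutes half_edges ?m"
    unfolding face_perm_def glue_simps(1,2)
    by (intro permutes_compose perm unicellular_edge_permutes[OF m])
  have c_less: "pos m c < 2 * n" using pos_numbering(3)[OF m c] .
  have inj: "inj_on (glue_pos m a b c) (half_edges ?m)"
  proof (rule inj_onI)
    fix x y assume xy: "x \<in> half_edges ?m" "y \<in> half_edges ?m"
      "glue_pos m a b c x = glue_pos m a b c y"
    then have "pos m x = pos m y"
      using ab bc unfolding glue_pos_def by (auto split: if_splits)
    then show "x = y" using xy pos_eq_iff[OF m] by simp
  qed
  have less: "glue_pos m a b c h < card (half_edges ?m)" if "h \<in> half_edges ?m" for h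
    using pos_numbering(3)[OF m, of h] that c_less ab bc
    by (auto simp: glue_pos_def unicellular_card[OF m])
  have P0: "glue_pos m a b c (root_he ?m) = 0"
    by (simp add: glue_pos_def pos_numbering(2)[OF m])
  have PS: "glue_pos m a b c (face_perm ?m h) = Suc (glue_pos m a b c h)"
    if h: "h \<in> half_edges ?m" "Suc (glue_pos m a b c h) < card (half_edges ?m)" for h
  proof -
    note fp = glue_face_perm[OF ne, of m]
    have h': "h \<in> ?H" using h by simp
    have sa: "pos m (face_perm m a) = Suc (pos m a)"
      and sb: "pos m (face_perm m b) = Suc (pos m b)"
      using pos_less_imp_Suc[OF m] a b c ab bc by auto
    consider "h = a" | "h = b" | "h = c" | "h \<noteq> a" "h \<noteq> b" "h \<noteq> c" by blast
    then show ?thesis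
    proof cases
      case 1
      then show ?thesis using sb ab bc ne by (auto simp: fp glue_pos_def)
    next
      case 2
      \<comment> \<open>\<open>b\<close> now ends the exchanged blocks, at the old position of
        \<open>c\<close>; so the guard for \<open>b\<close> says that \<open>c\<close> was not the
        last half-edge.\<close>
      then have "Suc (pos m c) < 2 * n"
        using h ab bc unicellular_card[OF m] by (auto simp: glue_pos_def)
      then have "pos m (face_perm m c) = Suc (pos m c)" using pos_numbering(4)[OF m c] by simp
      then show ?thesis using 2 ab bc ne by (auto simp: fp glue_pos_def)
    next
      case 3
      then show ?thesis using sa ab bc ne by (auto simp: fp glue_pos_def)
    next
      case 4
      then have neq: "pos m h \<noteq> pos m a" "pos m h \<noteq> pos m b" "pos m h \<noteq> pos m c"
        using pos_eq_iff[OF m h'] a b c by auto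
      have "Suc (pos m h) < 2 * n"
        using h c_less ab bc neq unicellular_card[OF m] by (auto simp: glue_pos_def split: if_splits)
      then have "pos m (face_perm m h) = Suc (pos m h)" using pos_numbering(4)[OF m h'] by simp
      then show ?thesis using 4 neq ab bc by (auto simp: fp glue_pos_def)
    qed
  qed
  have root: "root_he ?m \<in> half_edges ?m" using m unicellular_root by simp
  have fin: "finite (half_edges ?m)" using m unicellular_finite by simp
  note num = cyclic_on_and_pos_of_numbering[where m = ?m, OF face fin root inj less P0 PS]
  show "unicellular n ?m"
    using m perm num(1) by (simp add: unicellular_def)
  show "pos ?m h = glue_pos m a b c h" if "h \<in> ?H"
    using num(2)[of h] that by simp
qed

section \<open>Vertices\<close>

lemma vertex_of_self: "unicellular n m \<Longrightarrow> h \<in> vertex_of m h"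
  unfolding vertex_of_def by (rule permutation_self_in_orbit[OF unicellular_vertex_permutation])

lemma vertex_of_subset: "unicellular n m \<Longrightarrow> h \<in> half_edges m \<Longrightarrow> vertex_of m h \<subseteq> half_edges m"
  unfolding vertex_of_def by (rule permutes_orbit_subset[OF unicellular_vertex_permutes])

lemma vertex_of_eq: "unicellular n m \<Longrightarrow> h \<in> vertex_of m k \<Longrightarrow> vertex_of m h = vertex_of m k"
  unfolding vertex_of_def by (rule orbit_eq_of_mem[OF unicellular_vertex_permutation])

lemma vertex_of_perm: "unicellular n m \<Longrightarrow> vertex_of m (vertex_perm m h) = vertex_of m h"
  unfolding vertex_of_def by (rule permutation_orbit_step[OF unicellular_vertex_permutation])

lemma vertex_in_vertices: "h \<in> half_edges m \<Longrightarrow> vertex_of m h \<in> vertices m"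
  by (simp add: vertices_def)

lemma vertices_subset:
  assumes "unicellular n m" "v \<in> vertices m"
  shows "v \<subseteq> half_edges m"
  using assms(2) vertex_of_subset[OF assms(1)] by (auto simp: vertices_def)

lemma vertices_nonempty:
  assumes "unicellular n m" "v \<in> vertices m"
  shows "v \<noteq> {}"
  using assms(2) vertex_of_self[OF assms(1)] by (auto simp: vertices_def)

lemma vertices_eq_vertex_of:
  assumes "unicellular n m" "v \<in> vertices m" "h \<in> v"
  shows "v = vertex_of m h"
proof -
  obtain k where "v = vertex_of m k" using assms(2) by (auto simp: vertices_def)
  then show ?thesis using vertex_of_eq[OF assms(1), of h k] assms(3) by simp
qed

lemma finite_vertices: "unicellular n m \<Longrightarrow> finite (vertices m)"
  unfolding vertices_def by (rule finite_imageI[OF unicellular_finite])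

lemma vmin_eqI:
  assumes m: "unicellular n m" and v: "v \<subseteq> half_edges m" and a: "a \<in> v"
    and min: "\<And>h. h \<in> v \<Longrightarrow> pos m a \<le> pos m h"
  shows "vmin m v = a"
  unfolding vmin_def
proof (rule the_equality)
  show "a \<in> v \<and> (\<forall>h'\<in>v. he_le m a h')"
    using assms by (meson he_le_iff_pos subsetD)
  fix h assume "h \<in> v \<and> (\<forall>h'\<in>v. he_le m h h')"
  then have "pos m h \<le> pos m a" "h \<in> v" using a v he_le_iff_pos[OF m] by blast+
  then show "h = a" using min[of h] pos_eq_iff[OF m, of h a] a v by auto
qed

text \<open>Stated for any nonempty set of half-edges, because slicing takes the minimum of a mere
  part of a vertex.\<close>

lemma vmin_of_subset:
  assumes m: "unicellular n m" and v: "v \<subseteq> half_edges m" "v \<noteq> {}"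
  shows "vmin m v \<in> v" and "h \<in> v \<Longrightarrow> pos m (vmin m v) \<le> pos m h"
proof -
  define a where "a = arg_min_on (pos m) v"
  have fin: "finite v" using v(1) unicellular_finite[OF m] by (rule finite_subset)
  have a: "a \<in> v" unfolding a_def using fin v(2) by (rule arg_min_if_finite)
  have le: "pos m a \<le> pos m h" if "h \<in> v" for h
    unfolding a_def using fin v(2) that by (rule arg_min_least)
  have "vmin m v = a" using m v(1) a le by (rule vmin_eqI)
  then show "vmin m v \<in> v" "h \<in> v \<Longrightarrow> pos m (vmin m v) \<le> pos m h" using a le by auto
qed

lemma vmin_vertex:
  assumes m: "unicellular n m" and v: "v \<in> vertices m"
  shows "vmin m v \<in> v" and "h \<in> v \<Longrightarrow> pos m (vmin m v) \<le> pos m h"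
    and "vmin m v \<in> half_edges m" and "vertex_of m (vmin m v) = v"
proof -
  note vm = vmin_of_subset[OF m vertices_subset[OF m v] vertices_nonempty[OF m v]]
  show "vmin m v \<in> v" "h \<in> v \<Longrightarrow> pos m (vmin m v) \<le> pos m h" using vm by auto
  then show "vmin m v \<in> half_edges m" "vertex_of m (vmin m v) = v"
    using vertices_subset[OF m v] vertices_eq_vertex_of[OF m v] by auto
qed

lemma vertex_less_iff_pos:
  assumes "unicellular n m" "v \<in> vertices m" "w \<in> vertices m"
  shows "vertex_less m v w \<longleftrightarrow> pos m (vmin m v) < pos m (vmin m w)"
  unfolding vertex_less_def he_less_iff_pos[OF assms(1)]
  using vmin_vertex(3)[OF assms(1,2)] vmin_vertex(3)[OF assms(1,3)] by blast

text \<open>Two merges by transpositions. The first claim records the intermediate state: undoing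
  the second transposition leaves \<open>b\<close> and \<open>c\<close> in a common cycle without
  \<open>a\<close>, the part of the merged vertex in which slicing looks for the middle gluing
  point.\<close>

lemma glue_vertex_of:
  assumes m: "unicellular n m"
    and ab: "vertex_of m a \<noteq> vertex_of m b" and bc: "vertex_of m b \<noteq> vertex_of m c"
    and ac: "vertex_of m a \<noteq> vertex_of m c"
  defines "W \<equiv> vertex_of m a \<union> vertex_of m b \<union> vertex_of m c"
  shows "orbit (vertex_perm (glue m a b c) \<circ> transpose a c) c = vertex_of m b \<union> vertex_of m c"
    and "h \<in> W \<Longrightarrow> vertex_of (glue m a b c) h = W"
    and "h \<notin> W \<Longrightarrow> vertex_of (glue m a b c) h = vertex_of m h"
proof -
  let ?s = "vertex_perm m"
  have s: "permutation ?s" using m by (rule unicellular_vertex_permutation)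
  define t where "t = ?s \<circ> transpose b c"
  have t: "permutation t" unfolding t_def by (rule permutation_comp_transpose[OF s])
  have ne: "a \<noteq> b" "b \<noteq> c" "a \<noteq> c" using ab bc ac by metis+
  have g: "vertex_perm (glue m a b c) = t \<circ> transpose a c"
    unfolding t_def using ne by (rule glue_vertex_perm_transposes)
  have gp: "permutation (vertex_perm (glue m a b c))"
    unfolding g by (rule permutation_comp_transpose[OF t])
  have nin: "x \<notin> orbit ?s y" if "vertex_of m x \<noteq> vertex_of m y" for x y
    using that vertex_of_eq[OF m, of x y] by (metis vertex_of_def)
  have tc: "orbit t c = vertex_of m b \<union> vertex_of m c"
    using orbit_comp_transpose_merge[OF s nin[OF bc]]
    unfolding t_def vertex_of_def by (simp add: transpose_commute Un_commute)
  have "vertex_perm (glue m a b c) \<circ> transpose a c = t" unfolding g by (simp add: fun_eq_iff)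
  then show "orbit (vertex_perm (glue m a b c) \<circ> transpose a c) c = vertex_of m b \<union> vertex_of m c"
    using tc by simp
  have ta: "orbit t a = vertex_of m a"
    unfolding t_def vertex_of_def
    by (rule orbit_comp_transpose_other[OF s nin[OF ab[symmetric]] nin[OF ac[symmetric]]])
  have "a \<notin> orbit t c" using tc nin[OF ab] nin[OF ac] unfolding vertex_of_def by simp
  then have W: "orbit (t \<circ> transpose a c) c = W"
    using orbit_comp_transpose_merge[OF t, of a c] ta tc
    unfolding W_def by (simp add: transpose_commute Un_commute Un_left_commute)
  then show "vertex_of (glue m a b c) h = W" if "h \<in> W"
    using orbit_eq_of_mem[OF gp, of h c] that unfolding vertex_of_def g by simp
  show "vertex_of (glue m a b c) h = vertex_of m h" if h: "h \<notin> W"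
  proof -
    have nv: "vertex_of m a \<noteq> vertex_of m h" "vertex_of m b \<noteq> vertex_of m h"
      "vertex_of m c \<noteq> vertex_of m h"
      using h vertex_of_self[OF m] unfolding W_def by blast+
    have th: "orbit t h = vertex_of m h"
      unfolding t_def vertex_of_def
      by (rule orbit_comp_transpose_other[OF s nin[OF nv(2)] nin[OF nv(3)]])
    then have "a \<notin> orbit t h" "c \<notin> orbit t h"
      using nin[OF nv(1)] nin[OF nv(3)] unfolding vertex_of_def by simp_all
    then show ?thesis
      using orbit_comp_transpose_other[OF t, of a h c] th unfolding g vertex_of_def by simp
  qed
qed

lemma glue_card_vertices:
  assumes m: "unicellular n m"
    and H: "a \<in> half_edges m" "b \<in> half_edges m" "c \<in> half_edges m"
    and ab: "vertex_of m a \<noteq> vertex_of m b" and bc: "vertex_of m b \<noteq> vertex_of m c"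
    and ac: "vertex_of m a \<noteq> vertex_of m c"
  shows "card (vertices (glue m a b c)) + 2 = card (vertices m)"
proof -
  define W where "W = vertex_of m a \<union> vertex_of m b \<union> vertex_of m c"
  let ?T = "{vertex_of m a, vertex_of m b, vertex_of m c}"
  note g = glue_vertex_of[OF m ab bc ac, folded W_def]
  have in_W: "h \<in> W \<longleftrightarrow> vertex_of m h \<in> ?T" for h
    using vertex_of_eq[OF m, of h a] vertex_of_eq[OF m, of h b] vertex_of_eq[OF m, of h c]
      vertex_of_self[OF m, of h] unfolding W_def by auto
  have W_nin: "W \<notin> vertices m"
  proof
    assume W: "W \<in> vertices m"
    have "a \<in> W" "b \<in> W" using vertex_of_self[OF m] by (auto simp: W_def)
    then show False using vertices_eq_vertex_of[OF m W, of a] vertices_eq_vertex_of[OF m W, of b] ab by simp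
  qed
  have "vertices (glue m a b c) = insert W (vertices m - ?T)"
  proof (intro set_eqI iffI)
    fix x assume "x \<in> vertices (glue m a b c)"
    then obtain h where "h \<in> half_edges m" "x = vertex_of (glue m a b c) h"
      by (auto simp: vertices_def)
    then show "x \<in> insert W (vertices m - ?T)"
      using g(2,3)[of h] in_W[of h] vertex_in_vertices[of h m] by (cases "h \<in> W") simp_all
  next
    fix x assume x: "x \<in> insert W (vertices m - ?T)"
    show "x \<in> vertices (glue m a b c)"
    proof (cases "x = W")
      case True
      have "a \<in> W" using vertex_of_self[OF m] by (simp add: W_def)
      then have "vertex_of (glue m a b c) a = x" using g(2)[of a] True by simp
      then show ?thesis using H(1) vertex_in_vertices[of a "glue m a b c"] by simp
    next
      case False
      then obtain h where h: "h \<in> half_edges m" "x = vertex_of m h" "x \<notin> ?T"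
        using x unfolding vertices_def by blast
      then have "h \<notin> W" using in_W[of h] by simp
      then have "vertex_of (glue m a b c) h = x" using g(3)[of h] h(2) by simp
      then show ?thesis using h(1) vertex_in_vertices[of h "glue m a b c"] by simp
    qed
  qed
  moreover have "?T \<subseteq> vertices m" using H by (simp add: vertex_in_vertices)
  moreover have card_T: "card ?T = 3" using ab bc ac by simp
  ultimately show ?thesis
    using W_nin finite_vertices[OF m] card_mono[of "vertices m" ?T]
    by (simp add: card_Diff_subset card_insert_if del: insert_subset)
qed

section \<open>One gluing step and its inverse\<close>

text \<open>A trisection \<open>\<tau>\<close> is handled through \<open>b = \<sigma>(\<tau>)\<close>, which stays fixed while gluing. The half-edges
  \<open>b\<close> with \<open>b \<le> \<sigma>\<^sup>-\<^sup>1(b)\<close> are exactly these together with the minima of the vertices, so that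
  \<open>\<Phi>\<close> and \<open>\<Psi>\<close> become the same operation.\<close>

definition desc_at :: "'h rooted_map \<Rightarrow> 'h \<Rightarrow> bool" where
  "desc_at m b \<longleftrightarrow> b \<in> half_edges m \<and>
     (\<exists>h\<in>half_edges m. vertex_perm m h = b \<and> pos m b \<le> pos m h)"

text \<open>The list \<open>vs\<close> holds the vertices still to be glued, in decreasing order.\<close>

definition gluable :: "nat \<Rightarrow> 'h rooted_map \<Rightarrow> 'h set list \<Rightarrow> 'h \<Rightarrow> bool" where
  "gluable n m vs b \<longleftrightarrow> unicellular n m \<and> desc_at m b \<and> set vs \<subseteq> vertices m \<and>
     sorted_wrt (\<lambda>v w. vertex_less m w v) (vertex_of m b # vs)"

lemma gluable_unicellular: "gluable n m vs b \<Longrightarrow> unicellular n m"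
  and gluable_half_edge: "gluable n m vs b \<Longrightarrow> b \<in> half_edges m"
  by (auto simp: gluable_def desc_at_def)

lemma glue_gluable:
  assumes gl: "gluable n m (w # v # vs) b"
  defines "a \<equiv> vmin m v" and "c \<equiv> vmin m w"
  defines "m' \<equiv> glue m a c b"
  shows "gluable n m' vs b"
    and "u \<in> set vs \<Longrightarrow> vmin m' u = vmin m u"
    and "vmin m' (vertex_of m' b) = a" and "a \<noteq> b"
    and "card (vertices m') + 2 = card (vertices m)"
    and "orbit (vertex_perm m' \<circ> transpose a b) b = w \<union> vertex_of m b"
    and "pos m' b < pos m' c"
    and "h \<in> w \<union> vertex_of m b \<Longrightarrow> pos m' b < pos m' h \<Longrightarrow> pos m' c \<le> pos m' h"
    and "a \<in> half_edges m" and "c \<in> half_edges m" and "a \<noteq> c" and "c \<noteq> b"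
    and "vertex_perm m x = b \<Longrightarrow> x \<noteq> b \<Longrightarrow> vertex_perm m' x = b"
proof -
  let ?V = "vertex_of m b"
  have m: "unicellular n m" and b: "b \<in> half_edges m" and desc: "desc_at m b"
    and w: "w \<in> vertices m" and v: "v \<in> vertices m" and vs: "set vs \<subseteq> vertices m"
    and sorted: "sorted_wrt (\<lambda>v w. vertex_less m w v) (vertex_of m b # w # v # vs)"
    using gl by (auto simp: gluable_def desc_at_def)
  have V: "?V \<in> vertices m" using b by (rule vertex_in_vertices)
  note vw = vmin_vertex[OF m w, folded c_def] and vv = vmin_vertex[OF m v, folded a_def]
    and vV = vmin_vertex[OF m V]
  have ac: "pos m a < pos m c" and cV: "pos m c < pos m (vmin m ?V)"
    using sorted vertex_less_iff_pos[OF m] v w V by (auto simp: a_def c_def)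
  have Vb: "pos m (vmin m ?V) \<le> pos m b" using vV(2) vertex_of_self[OF m] by blast
  have cb: "pos m c < pos m b" using cV Vb by simp
  show aH: "a \<in> half_edges m" and cH: "c \<in> half_edges m" using vv vw by auto
  have pos: "pos m' h = glue_pos m a c b h" if "h \<in> half_edges m" for h
    unfolding m'_def by (rule glue_unicellular(2)[OF m aH cH b ac cb that])
  have m': "unicellular n m'"
    unfolding m'_def by (rule glue_unicellular(1)[OF m aH cH b ac cb])
  have HH: "half_edges m' = half_edges m" by (simp add: m'_def)
  have va: "vertex_of m a = v" and vc: "vertex_of m c = w" using vv vw by auto
  have dist: "v \<noteq> w" "w \<noteq> ?V" "v \<noteq> ?V" using ac cV by (auto simp: a_def c_def)
  define W where "W = v \<union> w \<union> ?V"
  note g = glue_vertex_of[OF m, of a c b, unfolded va vc, OF dist, folded W_def m'_def]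
  have bW: "b \<in> W" and aW: "a \<in> W" using vertex_of_self[OF m] vv by (auto simp: W_def)
  have W_sub: "W \<subseteq> half_edges m" unfolding W_def using vertices_subset[OF m] v w V by blast
  have V': "vertex_of m' b = W" using g(2)[OF bW] .
  have ge_c: "pos m c \<le> pos m h" "pos m h = pos m c \<longleftrightarrow> h = c" if "h \<in> w \<union> ?V" for h
  proof -
    show "pos m c \<le> pos m h" using that vw(2) vV(2) cV by fastforce
    show "pos m h = pos m c \<longleftrightarrow> h = c"
      using that W_sub cH by (intro pos_eq_iff[OF m]) (auto simp: W_def)
  qed
  have ge_a: "pos m a \<le> pos m h" if "h \<in> W" for h
    using that vv(2) ge_c(1)[of h] ac unfolding W_def by fastforce
  show vmin': "vmin m' (vertex_of m' b) = a"
    unfolding V'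
  proof (rule vmin_eqI[OF m'])
    show "pos m' a \<le> pos m' h" if "h \<in> W" for h
      using ge_a[OF that] ac cb pos[OF subsetD[OF W_sub that]] pos[OF aH] by (auto simp: glue_pos_def)
  qed (use aW W_sub HH in auto)
  show ne: "a \<noteq> b" "a \<noteq> c" "c \<noteq> b" using ac cb by auto
  show "card (vertices m') + 2 = card (vertices m)"
    unfolding m'_def by (rule glue_card_vertices[OF m aH cH b]) (use dist va vc in auto)
  show "orbit (vertex_perm m' \<circ> transpose a b) b = w \<union> ?V" by (fact g(1))
  show "pos m' b < pos m' c"
    using pos[OF b] pos[OF cH] ac cb by (auto simp: glue_pos_def)
  show "pos m' c \<le> pos m' h" if "h \<in> w \<union> ?V" "pos m' b < pos m' h"
  proof -
    have "h \<in> half_edges m" using that(1) W_sub by (auto simp: W_def)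
    from pos[OF this] show ?thesis
      using that(2) ge_c[OF that(1)] pos[OF b] pos[OF cH] ac cb
      by (auto simp: glue_pos_def split: if_splits)
  qed
  have u: "u \<in> vertices m'" "vmin m' u = vmin m u" "pos m' (vmin m u) = pos m (vmin m u)"
    "pos m (vmin m u) < pos m a" if "u \<in> set vs" for u
  proof -
    have um: "u \<in> vertices m" using that vs by auto
    note vu = vmin_vertex[OF m um]
    show ua: "pos m (vmin m u) < pos m a"
      using sorted that vertex_less_iff_pos[OF m um v] by (auto simp: a_def)
    then have "vmin m u \<notin> W" using ge_a by force
    then have "vertex_of m' (vmin m u) = u" using g(3) vu(4) by simp
    then show "u \<in> vertices m'" using vu(3) vertex_in_vertices[of "vmin m u" m'] HH by auto
    show pu: "pos m' (vmin m u) = pos m (vmin m u)"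
      using pos[OF vu(3)] ua by (simp add: glue_pos_def)
    show "vmin m' u = vmin m u"
    proof (rule vmin_eqI[OF m' _ vu(1)])
      show uH: "u \<subseteq> half_edges m'" using vertices_subset[OF m um] HH by simp
      show "pos m' (vmin m u) \<le> pos m' h" if "h \<in> u" for h
      proof -
        have "h \<in> half_edges m" using uH HH that by auto
        from pos[OF this] show ?thesis
          using vu(2)[OF that] pu ua ac cb by (auto simp: glue_pos_def)
      qed
    qed
  qed
  show "u \<in> set vs \<Longrightarrow> vmin m' u = vmin m u" by (fact u(2))
  \<comment> \<open>A predecessor of \<open>b\<close> belongs to the vertex of \<open>b\<close>,
    hence is neither \<open>a\<close> nor \<open>c\<close>; unless it is \<open>b\<close> itself,
    its image is unchanged.\<close>
  have keep: "vertex_perm m' x = b" if "vertex_perm m x = b" "x \<noteq> b" for x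
  proof -
    have "vertex_of m x = ?V" using vertex_of_perm[OF m, of x] that by simp
    then have "x \<noteq> a" "x \<noteq> c" using va vc dist by auto
    then show ?thesis using that by (simp add: m'_def)
  qed
  then show "vertex_perm m x = b \<Longrightarrow> x \<noteq> b \<Longrightarrow> vertex_perm m' x = b" .
  have "desc_at m' b"
  proof -
    obtain h where h: "h \<in> half_edges m" "vertex_perm m h = b" "pos m b \<le> pos m h"
      using desc by (auto simp: desc_at_def)
    show ?thesis
    proof (cases "h = b")
      case True
      \<comment> \<open>The vertex of \<open>b\<close> had degree one. The new predecessor of
        \<open>b\<close> is \<open>c\<close>, which gluing has moved behind
        \<open>b\<close>.\<close>
      then have "vertex_perm m' c = b" using h ne by (simp add: m'_def)
      moreover have "pos m' b \<le> pos m' c"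
        using pos[OF b] pos[OF cH] ac cb by (auto simp: glue_pos_def)
      ultimately show ?thesis using b cH HH unfolding desc_at_def by auto
    next
      case False
      then have "pos m b < pos m h" using h b pos_eq_iff[OF m, of h b] by auto
      then have "pos m' b \<le> pos m' h" using pos[OF b] pos[OF h(1)] ac cb by (auto simp: glue_pos_def)
      then show ?thesis using keep[OF h(2) False] h(1) b HH unfolding desc_at_def by auto
    qed
  qed
  moreover have "vertex_less m' u (vertex_of m' b)" if "u \<in> set vs" for u
  proof -
    have "vertex_of m' b \<in> vertices m'" using b HH vertex_in_vertices by metis
    moreover have "pos m' a = pos m a" using pos[OF aH] by (simp add: glue_pos_def)
    ultimately show ?thesis using u[OF that] vmin' vertex_less_iff_pos[OF m' u(1)[OF that]] by simp
  qed
  moreover have "sorted_wrt (\<lambda>v w. vertex_less m' w v) vs"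
  proof (rule sorted_wrt_mono_rel[of vs "\<lambda>v w. vertex_less m w v"])
    show "sorted_wrt (\<lambda>v w. vertex_less m w v) vs" using sorted by simp
    show "vertex_less m' y x" if xy: "x \<in> set vs" "y \<in> set vs" "vertex_less m y x" for x y
      using vertex_less_iff_pos[OF m, of y x] vertex_less_iff_pos[OF m', of y x] u[OF xy(1)] u[OF xy(2)]
        vs xy by auto
  qed
  ultimately show "gluable n m' vs b"
    using m' u(1) unfolding gluable_def by auto
qed

text \<open>Swapping the images of \<open>a\<close> and \<open>b\<close> cuts the vertex of
  \<open>b\<close> in two; \<open>T\<close> is the piece of \<open>b\<close>. The predecessor
  \<open>x\<close> of \<open>b\<close> stays in \<open>T\<close> and by \<open>desc_at\<close> comes
  after \<open>b\<close>, so there is a first element \<open>c\<close> of \<open>T\<close> after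
  \<open>b\<close>. Gluing at \<open>a\<close>, \<open>b\<close>, \<open>c\<close> cuts
  \<open>T\<close> once more and is inverted by gluing at \<open>a\<close>, \<open>c\<close>,
  \<open>b\<close>.\<close>

lemma slice_gluable:
  assumes gl: "gluable n m' vs b" and not_min: "b \<noteq> vmin m' (vertex_of m' b)"
  obtains m v w where "gluable n m (w # v # vs) b" "m' = glue m (vmin m v) (vmin m w) b"
proof -
  let ?s = "vertex_perm m'"
  define V where "V = vertex_of m' b"
  define a where "a = vmin m' V"
  have m': "unicellular n m'" and b: "b \<in> half_edges m'" and desc: "desc_at m' b"
    and vs: "set vs \<subseteq> vertices m'"
    and sorted: "sorted_wrt (\<lambda>v w. vertex_less m' w v) (V # vs)"
    using gl by (auto simp: gluable_def desc_at_def V_def)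
  have s: "permutation ?s" using m' by (rule unicellular_vertex_permutation)
  have V: "V \<in> vertices m'" unfolding V_def using b by (rule vertex_in_vertices)
  note vV = vmin_vertex[OF m' V, folded a_def]
  have ab: "a \<noteq> b" using not_min by (auto simp: a_def V_def)
  have bV: "b \<in> V" unfolding V_def by (rule vertex_of_self[OF m'])
  have pab: "pos m' a < pos m' b" using vV(2)[OF bV] vV(3) ab pos_eq_iff[OF m' vV(3) b] by auto
  have Va: "V = orbit ?s a" using vV(4) by (simp add: vertex_of_def)
  define t where "t = ?s \<circ> transpose a b"
  have t: "permutation t" unfolding t_def by (rule permutation_comp_transpose[OF s])
  define T where "T = orbit t b"
  have V_split: "V = orbit t a \<union> T" and b_nin: "b \<notin> orbit t a"
    using orbit_comp_transpose_split[OF s, of b a] bV ab unfolding Va T_def t_def by auto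
  have T_sub: "T \<subseteq> V" using V_split by blast
  have V_sub: "V \<subseteq> half_edges m'" using vertices_subset[OF m' V] .
  have disj: "orbit t a \<inter> T = {}"
  proof -
    have False if "x \<in> orbit t a" "x \<in> orbit t b" for x
      using orbit_eq_of_mem[OF t that(1)] orbit_eq_of_mem[OF t that(2)] b_nin
        permutation_self_in_orbit[OF t, of b] by auto
    then show ?thesis by (auto simp: T_def)
  qed
  have a_nin: "a \<notin> T" using disj permutation_self_in_orbit[OF t, of a] by blast
  have bT: "b \<in> T" unfolding T_def by (rule permutation_self_in_orbit[OF t])
  obtain x where x: "x \<in> half_edges m'" "?s x = b" "pos m' b \<le> pos m' x"
    using desc by (auto simp: desc_at_def)
  have xb: "x \<noteq> b"
  proof
    assume "x = b"
    then have "V = {b}" using x unfolding V_def vertex_of_def by (simp add: orbit_eq_singleton_iff)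
    then show False using vV(1) ab by auto
  qed
  have pbx: "pos m' b < pos m' x" using x xb pos_eq_iff[OF m' x(1) b] by auto
  have xa: "x \<noteq> a" using pbx pab by auto
  have xT: "x \<in> T"
  proof -
    have "t x = b" using x xb xa by (simp add: t_def)
    then show ?thesis unfolding T_def
      using permutation_orbit_step[OF t, of x] permutation_self_in_orbit[OF t, of x] by simp
  qed
  let ?C = "{h \<in> T. pos m' b < pos m' h}"
  define c where "c = vmin m' ?C"
  have C: "?C \<subseteq> half_edges m'" "?C \<noteq> {}" using T_sub V_sub xT pbx by auto
  note vC = vmin_of_subset[OF m' C, folded c_def]
  have cT: "c \<in> T" and pbc: "pos m' b < pos m' c" using vC(1) by auto
  have cH: "c \<in> half_edges m'" using cT T_sub V_sub by auto
  have ne: "a \<noteq> b" "b \<noteq> c" "a \<noteq> c" using pab pbc by auto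
  define m where "m = glue m' a b c"
  have m: "unicellular n m"
    unfolding m_def by (rule glue_unicellular(1)[OF m' vV(3) b cH pab pbc])
  have pos: "pos m h = glue_pos m' a b c h" if "h \<in> half_edges m'" for h
    unfolding m_def by (rule glue_unicellular(2)[OF m' vV(3) b cH pab pbc that])
  have HH: "half_edges m = half_edges m'" by (simp add: m_def)
  have sm: "vertex_perm m = t \<circ> transpose b c"
    unfolding m_def t_def using ne by (rule glue_vertex_perm_transposes')
  define v w where "v = vertex_of m a" and "w = vertex_of m c"
  have T_split: "T = vertex_of m b \<union> w" and c_nin: "c \<notin> vertex_of m b"
    using orbit_comp_transpose_split[OF t, of c b] cT ne
    unfolding T_def vertex_of_def w_def sm by auto
  have v_eq: "v = orbit t a"
    unfolding v_def vertex_of_def sm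
    using orbit_comp_transpose_other[OF t b_nin] disj cT by blast
  have v_in: "v \<in> vertices m" and w_in: "w \<in> vertices m" and b_in: "vertex_of m b \<in> vertices m"
    unfolding v_def w_def using vertex_in_vertices vV(3) cH b HH by metis+
  have pos_a: "pos m a = pos m' a" using pos[OF vV(3)] by (simp add: glue_pos_def)
  have vmin_v: "vmin m v = a"
  proof (rule vmin_eqI[OF m vertices_subset[OF m v_in]])
    show "a \<in> v" unfolding v_def by (rule vertex_of_self[OF m])
    show "pos m a \<le> pos m h" if "h \<in> v" for h
    proof -
      have "h \<in> V" using that V_split v_eq by auto
      then have le: "pos m' a \<le> pos m' h" and hH: "h \<in> half_edges m'" using vV(2) V_sub by auto
      then show ?thesis using pos_a pos[OF hH] pab pbc by (auto simp: glue_pos_def)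
    qed
  qed
  \<comment> \<open>\<open>T\<close> has no element up to \<open>a\<close> and none strictly between
    \<open>b\<close> and \<open>c\<close>. Once the two blocks have changed places, \<open>c\<close>
    precedes the rest of \<open>T\<close>, hence both pieces into which \<open>T\<close> is cut have
    minima at or after \<open>c\<close>.\<close>
  have c_min: "pos m c \<le> pos m h" if h: "h \<in> T" for h
  proof -
    have hH: "h \<in> half_edges m'" and "pos m' a \<le> pos m' h" using h T_sub V_sub vV(2) by auto
    moreover have "pos m' a \<noteq> pos m' h" using a_nin h pos_eq_iff[OF m' vV(3) hH] by auto
    moreover have "pos m' c \<le> pos m' h" if "pos m' b < pos m' h" using vC(2) h that by auto
    ultimately show ?thesis
      using pos[OF hH] pos[OF cH] pab pbc by (auto simp: glue_pos_def)
  qed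
  have vmin_w: "vmin m w = c"
  proof (rule vmin_eqI[OF m vertices_subset[OF m w_in]])
    show "c \<in> w" unfolding w_def by (rule vertex_of_self[OF m])
  qed (use c_min T_split in auto)
  have less_b: "pos m c < pos m (vmin m (vertex_of m b))"
  proof -
    note vb = vmin_vertex[OF m b_in]
    have "vmin m (vertex_of m b) \<noteq> c" using vb(1) c_nin by auto
    then show ?thesis
      using c_min[of "vmin m (vertex_of m b)"] vb(1) T_split pos_eq_iff[OF m, of _ c] cH vb(3) HH
      by (metis Un_iff le_neq_implies_less)
  qed
  have less_ac: "pos m a < pos m c" using pos[OF cH] pos_a pab pbc by (simp add: glue_pos_def)
  have u: "u \<in> vertices m" "vmin m u = vmin m' u" "pos m (vmin m' u) = pos m' (vmin m' u)"
    "pos m' (vmin m' u) < pos m' a" if "u \<in> set vs" for u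
  proof -
    have um: "u \<in> vertices m'" using that vs by auto
    note vu = vmin_vertex[OF m' um]
    show ua: "pos m' (vmin m' u) < pos m' a"
      using sorted that vertex_less_iff_pos[OF m' um V] by (auto simp: a_def)
    then have uV: "vmin m' u \<notin> V" using vV(2) by force
    have nV: "x \<notin> orbit ?s (vmin m' u)" if "x \<in> V" for x
      using uV that vertex_of_eq[OF m', of x] vertices_eq_vertex_of[OF m' V that]
        vertex_of_self[OF m'] unfolding vertex_of_def by metis
    have tu: "orbit t (vmin m' u) = orbit ?s (vmin m' u)"
      unfolding t_def by (rule orbit_comp_transpose_other[OF s nV[OF vV(1)] nV[OF bV]])
    have "c \<in> V" using cT T_sub by auto
    then have "orbit (vertex_perm m) (vmin m' u) = orbit ?s (vmin m' u)"
      unfolding sm using orbit_comp_transpose_other[OF t] tu nV bV by auto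
    then have "vertex_of m (vmin m' u) = u" using vu(4) unfolding vertex_of_def by simp
    then show "u \<in> vertices m" using vu(3) vertex_in_vertices[of "vmin m' u" m] HH by auto
    show pu: "pos m (vmin m' u) = pos m' (vmin m' u)"
      using pos[OF vu(3)] ua by (simp add: glue_pos_def)
    show "vmin m u = vmin m' u"
    proof (rule vmin_eqI[OF m _ vu(1)])
      show uH: "u \<subseteq> half_edges m" using vertices_subset[OF m' um] HH by simp
      show "pos m (vmin m' u) \<le> pos m h" if "h \<in> u" for h
      proof -
        have "h \<in> half_edges m'" using uH HH that by auto
        from pos[OF this] show ?thesis
          using vu(2)[OF that] pu ua pab pbc by (auto simp: glue_pos_def)
      qed
    qed
  qed
  have desc_m: "desc_at m b"
  proof (cases "x = c")
    case True
    \<comment> \<open>If \<open>c\<close> is the predecessor of \<open>b\<close>, the second cut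
      leaves \<open>b\<close> as a vertex of degree one, its own predecessor.\<close>
    then have "vertex_perm m b = b" using x ne by (simp add: m_def)
    then show ?thesis using b HH unfolding desc_at_def by auto
  next
    case False
    then have "vertex_perm m x = b" using x xa xb by (simp add: m_def)
    moreover have "pos m' c < pos m' x"
      using vC(2)[of x] xT pbx False pos_eq_iff[OF m' x(1) cH] by fastforce
    then have "pos m b \<le> pos m x" using pos[OF b] pos[OF x(1)] pab pbc by (auto simp: glue_pos_def)
    ultimately show ?thesis using x(1) b HH unfolding desc_at_def by auto
  qed
  have sorted_vs: "sorted_wrt (\<lambda>v w. vertex_less m w v) vs"
  proof (rule sorted_wrt_mono_rel[of vs "\<lambda>v w. vertex_less m' w v"])
    show "sorted_wrt (\<lambda>v w. vertex_less m' w v) vs" using sorted by simp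
    show "vertex_less m y x" if xy: "x \<in> set vs" "y \<in> set vs" "vertex_less m' y x" for x y
      using vertex_less_iff_pos[OF m', of y x] vertex_less_iff_pos[OF m, of y x] u[OF xy(1)] u[OF xy(2)]
        vs xy by auto
  qed
  have less: "vertex_less m y z \<longleftrightarrow> pos m (vmin m y) < pos m (vmin m z)"
    if "y \<in> insert v (insert w (insert (vertex_of m b) (set vs)))"
      "z \<in> insert v (insert w (insert (vertex_of m b) (set vs)))" for y z
    using that by (intro vertex_less_iff_pos[OF m]) (use v_in w_in b_in u(1) in auto)
  have "gluable n m (w # v # vs) b"
    unfolding gluable_def
  proof (intro conjI m desc_m)
    show "set (w # v # vs) \<subseteq> vertices m" using v_in w_in u(1) by auto
    have "vertex_less m u v" "vertex_less m u w" "vertex_less m u (vertex_of m b)"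
      if "u \<in> set vs" for u
      using that less u[OF that] vmin_v vmin_w less_b less_ac pos_a by auto
    then show "sorted_wrt (\<lambda>v w. vertex_less m w v) (vertex_of m b # w # v # vs)"
      using sorted_vs less vmin_v vmin_w less_b less_ac by auto
  qed
  moreover have "m' = glue m (vmin m v) (vmin m w) b"
    unfolding vmin_v vmin_w unfolding m_def using glue_glue[OF ne] by simp
  ultimately show ?thesis using that by blast
qed

section \<open>The number of vertices\<close>

text \<open>For an edge avoiding the root, of the two half-edges that \<open>\<gamma>\<close> maps onto it at most one is a
  descent of \<open>\<sigma> = \<alpha>\<gamma>\<close>.\<close>

lemma card_descents_le:
  assumes m: "unicellular n m"
  shows "card {h \<in> half_edges m. pos m (vertex_perm m h) \<le> pos m h} \<le> n + 1"
proof -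
  let ?H = "half_edges m" and ?s = "vertex_perm m" and ?al = "edge_inv m" and ?f = "face_perm m"
  define D where "D = {h \<in> ?H. pos m (?s h) \<le> pos m h}"
  define A where "A = {h \<in> ?H. pos m h < pos m (?s h)}"
  \<comment> \<open>The two half-edges that \<gamma> sends onto the edge of the root. The root does
    not come one position after its \<gamma>-predecessor, so the pairing below omits them; these two
    exceptions turn the bound \<open>n\<close> into \<open>n + 1\<close>.\<close>
  define e where "e = inv ?f (root_he m)"
  define e' where "e' = inv ?f (?al (root_he m))"
  \<comment> \<open>The other half-edge that \<gamma> sends onto the edge of \<open>?f h\<close>:
    \<gamma> maps it to \<sigma>(h) and \<sigma> maps it to \<gamma>(h). As positions rise by one
    along \<gamma>, a descent at \<open>h\<close> makes \<open>\<phi> h\<close> an ascent.\<close>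
  define \<phi> where "\<phi> h = inv ?f (?s h)" for h
  note face = unicellular_face_permutes[OF m] and sp = unicellular_vertex_permutes[OF m]
  have fin: "finite ?H" using m by (rule unicellular_finite)
  have inv_H: "inv ?f h \<in> ?H" if "h \<in> ?H" for h
    using that permutes_in_image[OF permutes_inv[OF face]] by simp
  have f_inv: "?f (inv ?f h) = h" for h using permutes_inverses(1)[OF face] .
  have al_al: "?al (?al h) = h" if "h \<in> ?H" for h using m that by (simp add: unicellular_def)
  have pos_inv: "pos m h = Suc (pos m (inv ?f h))" if h: "h \<in> ?H" "h \<noteq> root_he m" for h
  proof -
    have "pos m h \<noteq> 0"
      using pos_eq_iff[OF m h(1) unicellular_root[OF m]] pos_numbering(2)[OF m] h(2) by simp
    then obtain i where i: "pos m h = Suc i" using not0_implies_Suc by blast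
    have "?f ((?f ^^ i) (root_he m)) = h" using pos_numbering(6)[OF m h(1)] i by simp
    then have "inv ?f h = (?f ^^ i) (root_he m)" using permutes_inverses(2)[OF face] by metis
    then show ?thesis using pos_numbering(5)[OF m, of i] pos_numbering(3)[OF m h(1)] i by simp
  qed
  have "\<phi> ` (D - {e, e'}) \<subseteq> A"
  proof
    fix y assume "y \<in> \<phi> ` (D - {e, e'})"
    then obtain h where h: "h \<in> ?H" "pos m (?s h) \<le> pos m h" "h \<noteq> e" "h \<noteq> e'" "y = \<phi> h"
      by (auto simp: D_def)
    have sH: "?s h \<in> ?H" and fH: "?f h \<in> ?H"
      using h(1) permutes_in_image[OF sp] permutes_in_image[OF face] by auto
    have inv_f: "inv ?f (?f h) = h" using permutes_inverses(2)[OF face] .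
    have fh: "?f h = ?al (?s h)" by (simp add: face_perm_def)
    have "?f h \<noteq> root_he m" using h(3) inv_f by (auto simp: e_def)
    then have p1: "pos m (?f h) = Suc (pos m h)" using pos_inv[OF fH] inv_f by simp
    have "?s h \<noteq> root_he m" using h(4) inv_f fh by (auto simp: e'_def)
    then have p2: "pos m (?s h) = Suc (pos m y)" using pos_inv[OF sH] h(5) by (simp add: \<phi>_def)
    have yH: "y \<in> ?H" using h(5) inv_H[OF sH] by (simp add: \<phi>_def)
    have "?al (?s y) = ?s h" using f_inv[of "?s h"] h(5) by (simp add: \<phi>_def face_perm_def)
    then have "?s y = ?f h"
      using al_al[of "?s y"] permutes_in_image[OF sp] yH fh by simp
    then show "y \<in> A" using p1 p2 h(2) yH by (simp add: A_def)
  qed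
  moreover have "inj_on \<phi> (D - {e, e'})"
  proof (rule inj_onI)
    fix x y assume "\<phi> x = \<phi> y"
    then have "?s x = ?s y" unfolding \<phi>_def using f_inv by metis
    then show "x = y" using permutes_inj[OF sp] by (auto dest: injD)
  qed
  moreover have finA: "finite A" and finD: "finite D" using fin by (auto simp: A_def D_def)
  ultimately have "card (D - {e, e'}) \<le> card A" by (metis card_inj_on_le)
  moreover have "card D \<le> card (D - {e, e'}) + 2"
  proof -
    have "card D \<le> card ((D - {e, e'}) \<union> {e, e'})" using finD by (intro card_mono) auto
    also have "\<dots> \<le> card (D - {e, e'}) + card {e, e'}" by (rule card_Un_le)
    also have "card {e, e'} \<le> 2" by (simp add: card_insert_if)
    finally show ?thesis by simp
  qed
  moreover have "card A + card D = 2 * n"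
  proof -
    have "?H = A \<union> D" "A \<inter> D = {}" by (auto simp: A_def D_def)
    then show ?thesis using card_Un_disjoint[OF finA finD] unicellular_card[OF m] by simp
  qed
  ultimately show ?thesis unfolding D_def by simp
qed

text \<open>Non-negativity of the genus by counting: the half-edge that \<sigma> sends to the
  minimum of a vertex is a descent, and different vertices yield different ones.\<close>

lemma card_vertices_le:
  assumes m: "unicellular n m"
  shows "card (vertices m) \<le> n + 1"
proof -
  let ?s = "vertex_perm m"
  let ?D = "{h \<in> half_edges m. pos m (?s h) \<le> pos m h}"
  let ?p = "\<lambda>v. inv ?s (vmin m v)"
  have s_inv: "?s (inv ?s h) = h" for h
    using permutes_inverses(1)[OF unicellular_vertex_permutes[OF m]] .
  have "inj_on ?p (vertices m)"
  proof (rule inj_onI)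
    fix v w assume vw: "v \<in> vertices m" "w \<in> vertices m" "?p v = ?p w"
    have "vmin m v = ?s (?p v)" by (rule s_inv[symmetric])
    also have "\<dots> = ?s (?p w)" using vw(3) by simp
    also have "\<dots> = vmin m w" by (rule s_inv)
    finally have "vmin m v = vmin m w" .
    then show "v = w" using vmin_vertex(4)[OF m vw(1)] vmin_vertex(4)[OF m vw(2)] by metis
  qed
  moreover have "?p ` vertices m \<subseteq> ?D"
  proof
    fix h assume "h \<in> ?p ` vertices m"
    then obtain v where v: "v \<in> vertices m" "h = ?p v" by blast
    have sh: "?s h = vmin m v" using s_inv v(2) by simp
    then have "vertex_of m h = v" using vertex_of_perm[OF m, of h] vmin_vertex(4)[OF m v(1)] by simp
    then have "h \<in> v" using vertex_of_self[OF m, of h] by simp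
    then show "h \<in> ?D" using vertices_subset[OF m v(1)] vmin_vertex(2)[OF m v(1)] sh by auto
  qed
  ultimately have "card (vertices m) \<le> card ?D"
    by (rule card_inj_on_le) (simp add: unicellular_finite[OF m])
  with card_descents_le[OF m] show ?thesis by simp
qed

section \<open>Iterated gluing\<close>

text \<open>All steps of \<Lambda> in one recursion, with \<open>b\<close> as the third gluing point
  throughout. Minima are taken in the current map; the larger vertex \<open>w\<close> of each pair
  stands first because lists are decreasing.\<close>

fun glue_pairs :: "'h rooted_map \<Rightarrow> 'h set list \<Rightarrow> 'h \<Rightarrow> 'h rooted_map" where
  "glue_pairs m (w # v # vs) b = glue_pairs (glue m (vmin m v) (vmin m w) b) vs b"
| "glue_pairs m vs b = m"

lemma glue_pairs_append:
  "even (length xs) \<Longrightarrow> glue_pairs m (xs @ ys) b = glue_pairs (glue_pairs m xs b) ys b"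
  by (induction m xs b rule: glue_pairs.induct) auto

lemma glue_pairs_half_edges [simp]: "half_edges (glue_pairs m vs b) = half_edges m"
  by (induction m vs b rule: glue_pairs.induct) auto

text \<open>\<open>ys\<close> holds the vertices left over, so the invariant is available after
  every even prefix. The third conjunct is the stopping test for slicing: after a gluing, the
  minimum of the vertex of \<open>b\<close> is the point \<open>a\<close> of the latest step, never
  \<open>b\<close>.\<close>

lemma glue_pairs_gluable:
  assumes "gluable n m (xs @ ys) b" "even (length xs)"
  shows "gluable n (glue_pairs m xs b) ys b \<and>
    card (vertices (glue_pairs m xs b)) + length xs = card (vertices m) \<and>
    (xs \<noteq> [] \<longrightarrow> b \<noteq> vmin (glue_pairs m xs b) (vertex_of (glue_pairs m xs b) b))"
  using assms
proof (induction m xs b rule: glue_pairs.induct)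
  case (1 m w v vs b)
  note step = glue_gluable[where vs = "vs @ ys" and n = n and m = m and b = b and w = w and v = v]
  have gl: "gluable n m (w # v # vs @ ys) b" using 1 by simp
  have "gluable n (glue m (vmin m v) (vmin m w) b) (vs @ ys) b" using step(1)[OF gl] .
  then show ?case
    using 1 step(3,4,5)[OF gl] by (cases "vs = []") auto
qed auto

lemma not_vmin_vertex_perm_neq:
  assumes m: "unicellular n m" and b: "b \<in> half_edges m" and ne: "b \<noteq> vmin m (vertex_of m b)"
  shows "vertex_perm m b \<noteq> b"
proof
  assume "vertex_perm m b = b"
  then have "vertex_of m b = {b}" unfolding vertex_of_def by (simp add: orbit_eq_singleton_iff)
  then show False using vmin_vertex(1)[OF m vertex_in_vertices[OF b]] ne by simp
qed

text \<open>The vertices \<open>vs\<close> obtained so far are carried along: each slice puts its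
  two new vertices in front of them, and the order required by \<open>gluable\<close> makes the
  final list the one that \<Lambda> consumes.\<close>

lemma gluable_slice_completely:
  assumes "gluable n M vs b"
  shows "\<exists>m us. gluable n m (us @ vs) b \<and> even (length us) \<and> b = vmin m (vertex_of m b) \<and>
    M = glue_pairs m us b"
  using assms
proof (induction "n + 1 - card (vertices M)" arbitrary: M vs rule: less_induct)
  case less
  show ?case
  proof (cases "b = vmin M (vertex_of M b)")
    case True
    then show ?thesis using less.prems by (intro exI[of _ M] exI[of _ "[]"]) simp
  next
    case False
    then obtain m v w where gl: "gluable n m (w # v # vs) b"
      and M: "M = glue m (vmin m v) (vmin m w) b"
      using slice_gluable[OF less.prems] by blast
    have "card (vertices M) + 2 = card (vertices m)" using glue_gluable(5)[OF gl] M by simp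
    then have "n + 1 - card (vertices m) < n + 1 - card (vertices M)"
      using card_vertices_le[OF gluable_unicellular[OF gl]] by simp
    from less.hyps[OF this gl] obtain m0 us
      where us: "gluable n m0 (us @ w # v # vs) b" "even (length us)"
        "b = vmin m0 (vertex_of m0 b)" "m = glue_pairs m0 us b"
      by blast
    have "M = glue_pairs m0 (us @ [w, v]) b" using us(2,4) M by (simp add: glue_pairs_append)
    then show ?thesis using us by (intro exI[of _ m0] exI[of _ "us @ [w, v]"]) simp
  qed
qed

section \<open>Isomorphisms\<close>

lemma rooted_map_iso_bij: "rooted_map_iso f m m' \<Longrightarrow> bij_betw f (half_edges m) (half_edges m')"
  and rooted_map_iso_root: "rooted_map_iso f m m' \<Longrightarrow> f (root_he m) = root_he m'"
  and rooted_map_iso_edge: "rooted_map_iso f m m' \<Longrightarrow> h \<in> half_edges m \<Longrightarrow> f (edge_inv m h) = edge_inv m' (f h)"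
  and rooted_map_iso_vertex: "rooted_map_iso f m m' \<Longrightarrow> h \<in> half_edges m \<Longrightarrow> f (vertex_perm m h) = vertex_perm m' (f h)"
  by (auto simp: rooted_map_iso_def)

lemma rooted_map_iso_in: "rooted_map_iso f m m' \<Longrightarrow> h \<in> half_edges m \<Longrightarrow> f h \<in> half_edges m'"
  using bij_betwE[OF rooted_map_iso_bij] by blast

lemma rooted_map_iso_eq_iff:
  "rooted_map_iso f m m' \<Longrightarrow> x \<in> half_edges m \<Longrightarrow> y \<in> half_edges m \<Longrightarrow> f x = f y \<longleftrightarrow> x = y"
  using inj_on_eq_iff[OF bij_betw_imp_inj_on[OF rooted_map_iso_bij]] .

text \<open>An isomorphism commutes with \<alpha> and \<sigma>, hence with \<gamma>, and matches the
  roots; so it maps the i-th half-edge to the i-th.\<close>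

lemma rooted_map_iso_pos:
  assumes f: "rooted_map_iso f m m'" and m: "unicellular n m" and m': "unicellular n m'"
    and h: "h \<in> half_edges m"
  shows "pos m' (f h) = pos m h"
proof -
  have in_H: "(face_perm m ^^ i) (root_he m) \<in> half_edges m" for i
    using cyclic_on_funpow_in[OF unicellular_cyclic[OF m] unicellular_root[OF m]] .
  have pw: "f ((face_perm m ^^ i) (root_he m)) = (face_perm m' ^^ i) (root_he m')" for i
  proof (induction i)
    case 0
    then show ?case using rooted_map_iso_root[OF f] by simp
  next
    case (Suc i)
    let ?x = "(face_perm m ^^ i) (root_he m)"
    have "vertex_perm m ?x \<in> half_edges m"
      using permutes_in_image[OF unicellular_vertex_permutes[OF m]] in_H by blast
    then have "f (face_perm m ?x) = face_perm m' (f ?x)"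
      unfolding face_perm_def comp_def
      using rooted_map_iso_edge[OF f] rooted_map_iso_vertex[OF f in_H[of i]]
      by (simp add: face_perm_def comp_def)
    then show ?case using Suc by simp
  qed
  have "f h = (face_perm m' ^^ pos m h) (root_he m')"
    using pw[of "pos m h"] pos_numbering(6)[OF m h] by simp
  then show ?thesis using pos_numbering(5)[OF m' pos_numbering(3)[OF m h]] by simp
qed

lemma rooted_map_iso_vertex_of:
  assumes f: "rooted_map_iso f m m'" and m: "unicellular n m" and h: "h \<in> half_edges m"
  shows "f ` vertex_of m h = vertex_of m' (f h)"
  unfolding vertex_of_def
proof (rule orbit_inverse)
  show "h \<in> orbit (vertex_perm m) h" using vertex_of_self[OF m, of h] by (simp add: vertex_of_def)
  show "vertex_perm m' (f x) = f (vertex_perm m x)" if "x \<in> orbit (vertex_perm m) h" for x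
    using that vertex_of_subset[OF m h] rooted_map_iso_vertex[OF f, of x]
    by (auto simp: vertex_of_def)
qed

lemma rooted_map_iso_vertices:
  assumes f: "rooted_map_iso f m m'" and m: "unicellular n m" and v: "v \<in> vertices m"
  shows "f ` v \<in> vertices m'"
proof -
  obtain h where "h \<in> half_edges m" "v = vertex_of m h" using v by (auto simp: vertices_def)
  then show ?thesis
    using rooted_map_iso_vertex_of[OF f m] rooted_map_iso_in[OF f] by (simp add: vertex_in_vertices)
qed

lemma rooted_map_iso_vmin:
  assumes f: "rooted_map_iso f m m'" and m: "unicellular n m" and m': "unicellular n m'"
    and v: "v \<in> vertices m"
  shows "vmin m' (f ` v) = f (vmin m v)"
proof (rule vmin_eqI[OF m'])
  note vm = vmin_vertex[OF m v]
  show "f ` v \<subseteq> half_edges m'" using vertices_subset[OF m v] rooted_map_iso_in[OF f] by blast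
  show "f (vmin m v) \<in> f ` v" using vm(1) by blast
  show "pos m' (f (vmin m v)) \<le> pos m' h" if h: "h \<in> f ` v" for h
  proof -
    obtain x where x: "x \<in> v" "h = f x" using h by blast
    have "x \<in> half_edges m" using x(1) vertices_subset[OF m v] by blast
    then show ?thesis
      using vm(2)[OF x(1)] x(2) rooted_map_iso_pos[OF f m m'] vm(3) by simp
  qed
qed

lemma rooted_map_iso_vertex_less:
  assumes f: "rooted_map_iso f m m'" and m: "unicellular n m" and m': "unicellular n m'"
    and v: "v \<in> vertices m" and w: "w \<in> vertices m"
  shows "vertex_less m' (f ` v) (f ` w) \<longleftrightarrow> vertex_less m v w"
  using vertex_less_iff_pos[OF m v w]
    vertex_less_iff_pos[OF m' rooted_map_iso_vertices[OF f m v] rooted_map_iso_vertices[OF f m w]]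
    rooted_map_iso_vmin[OF f m m'] v w rooted_map_iso_pos[OF f m m'] vmin_vertex(3)[OF m]
  by simp

lemma rooted_map_iso_gluable:
  assumes f: "rooted_map_iso f m m'" and gl: "gluable n m vs b" and m': "unicellular n m'"
  shows "gluable n m' (map ((`) f) vs) (f b)"
proof -
  have m: "unicellular n m" and b: "b \<in> half_edges m" and vs: "set vs \<subseteq> vertices m"
    using gl by (auto simp: gluable_def desc_at_def)
  obtain h where h: "h \<in> half_edges m" "vertex_perm m h = b" "pos m b \<le> pos m h"
    using gl by (auto simp: gluable_def desc_at_def)
  have "desc_at m' (f b)"
    unfolding desc_at_def
  proof (intro conjI bexI[of _ "f h"])
    show "vertex_perm m' (f h) = f b" using rooted_map_iso_vertex[OF f h(1)] h(2) by simp
    show "pos m' (f b) \<le> pos m' (f h)" using rooted_map_iso_pos[OF f m m'] b h by simp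
  qed (use rooted_map_iso_in[OF f] b h(1) in auto)
  moreover have "set (map ((`) f) vs) \<subseteq> vertices m'"
    using vs rooted_map_iso_vertices[OF f m] by auto
  moreover have "sorted_wrt (\<lambda>v w. vertex_less m' w v) (map ((`) f) (vertex_of m b # vs))"
    unfolding sorted_wrt_map
  proof (rule sorted_wrt_mono_rel[of _ "\<lambda>v w. vertex_less m w v"])
    show "sorted_wrt (\<lambda>v w. vertex_less m w v) (vertex_of m b # vs)"
      using gl by (simp add: gluable_def)
    show "vertex_less m' (f ` y) (f ` x)"
      if "x \<in> set (vertex_of m b # vs)" "y \<in> set (vertex_of m b # vs)" "vertex_less m y x" for x y
    proof -
      have "x \<in> vertices m" "y \<in> vertices m" using that(1,2) vs vertex_in_vertices[OF b] by auto
      then show ?thesis using rooted_map_iso_vertex_less[OF f m m'] that(3) by simp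
    qed
  qed
  ultimately show ?thesis
    using m' rooted_map_iso_vertex_of[OF f m b] by (simp add: gluable_def)
qed

lemma rooted_map_iso_glue:
  assumes f: "rooted_map_iso f m m'"
    and H: "a \<in> half_edges m" "b \<in> half_edges m" "c \<in> half_edges m"
  shows "rooted_map_iso f (glue m a b c) (glue m' (f a) (f b) (f c))"
  using f H rooted_map_iso_eq_iff[OF f] unfolding rooted_map_iso_def by simp

lemma rooted_map_iso_glue_pairs:
  assumes "rooted_map_iso f m m'" "gluable n m vs b" "unicellular n m'"
  shows "rooted_map_iso f (glue_pairs m vs b) (glue_pairs m' (map ((`) f) vs) (f b))"
  using assms
proof (induction m vs b arbitrary: m' rule: glue_pairs.induct)
  case (1 m w v vs b)
  note f = 1(2) and gl = 1(3) and m' = 1(4)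
  have m: "unicellular n m" and v: "v \<in> vertices m" and w: "w \<in> vertices m"
    using gl by (auto simp: gluable_def)
  have gl': "gluable n m' ((f ` w) # (f ` v) # map ((`) f) vs) (f b)"
    using rooted_map_iso_gluable[OF f gl m'] by simp
  note vmin = rooted_map_iso_vmin[OF f m m' v] rooted_map_iso_vmin[OF f m m' w]
  have "rooted_map_iso f (glue m (vmin m v) (vmin m w) b)
      (glue m' (vmin m' (f ` v)) (vmin m' (f ` w)) (f b))"
    unfolding vmin
    using vmin_vertex(3)[OF m v] vmin_vertex(3)[OF m w] gluable_half_edge[OF gl]
    by (rule rooted_map_iso_glue[OF f])
  from 1(1)[OF this glue_gluable(1)[OF gl] gluable_unicellular[OF glue_gluable(1)[OF gl']]]
  show ?case by simp
qed auto

text \<open>\<open>glue_gluable\<close> describes both gluing points inside the glued map, and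
  \<open>f\<close> respects these descriptions, so it matches the points. As slicing is itself a
  gluing, the same \<open>f\<close> is an isomorphism of the sliced maps.\<close>

lemma rooted_map_iso_unglue:
  assumes gl: "gluable n m (w # v # vs) b" and gl': "gluable n m' (w' # v' # vs') b'"
    and f: "rooted_map_iso f (glue m (vmin m v) (vmin m w) b) (glue m' (vmin m' v') (vmin m' w') b')"
    and b': "f b = b'"
  shows "rooted_map_iso f m m'" and "f ` v = v'" and "f ` w = w'"
proof -
  define a c where "a = vmin m v" and "c = vmin m w"
  define a' c' where "a' = vmin m' v'" and "c' = vmin m' w'"
  define M where "M = glue m a c b"
  define M' where "M' = glue m' a' c' b'"
  note f = f[folded a_def c_def a'_def c'_def, folded M_def M'_def]
  note G = glue_gluable[OF gl, folded a_def c_def, folded M_def]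
  note G' = glue_gluable[OF gl', folded a'_def c'_def, folded M'_def]
  have m: "unicellular n m" and v: "v \<in> vertices m" and w: "w \<in> vertices m" and b: "b \<in> half_edges m"
    and m': "unicellular n m'" and v': "v' \<in> vertices m'" and w': "w' \<in> vertices m'"
    and b'H: "b' \<in> half_edges m'"
    using gl gl' by (auto simp: gluable_def desc_at_def)
  have M: "unicellular n M" and M': "unicellular n M'"
    using gluable_unicellular[OF G(1)] gluable_unicellular[OF G'(1)] by auto
  have HM: "half_edges M = half_edges m" and HM': "half_edges M' = half_edges m'"
    by (simp_all add: M_def M'_def)
  have bM: "b \<in> half_edges M" using b HM by simp
  have fa: "f a = a'"
    using rooted_map_iso_vmin[OF f M M' vertex_in_vertices[OF bM]]
      rooted_map_iso_vertex_of[OF f M bM] G(3) G'(3) b' by simp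
  let ?t = "vertex_perm M \<circ> transpose a b" and ?t' = "vertex_perm M' \<circ> transpose a' b'"
  define T where "T = w \<union> vertex_of m b"
  define T' where "T' = w' \<union> vertex_of m' b'"
  have T_sub: "T \<subseteq> half_edges M"
    using vertices_subset[OF m w] vertex_of_subset[OF m b] HM by (simp add: T_def)
  \<comment> \<open>Matching \<open>a\<close> with \<open>a'\<close> and \<open>b\<close> with
    \<open>b'\<close>, \<open>f\<close> intertwines the two cut permutations, hence maps the piece
    of \<open>b\<close> to the piece of \<open>b'\<close>.\<close>
  have "f ` orbit ?t b = orbit ?t' (f b)"
  proof (rule orbit_inverse)
    show "b \<in> orbit ?t b" using G(6) vertex_of_self[OF m, of b] by simp
    show "?t' (f x) = f (?t x)" if "x \<in> orbit ?t b" for x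
    proof -
      have x: "x \<in> half_edges M" using that G(6) T_sub by (auto simp: T_def)
      have aM: "a \<in> half_edges M" using G(9) HM by simp
      have "transpose a' b' (f x) = f (transpose a b x)"
        using rooted_map_iso_eq_iff[OF f x aM] rooted_map_iso_eq_iff[OF f x bM] fa b'
        by (auto simp: transpose_def)
      moreover have "transpose a b x \<in> half_edges M" using x aM bM by (simp add: transpose_def)
      ultimately show ?thesis using rooted_map_iso_vertex[OF f] by simp
    qed
  qed
  then have fT: "f ` T = T'" using G(6) G'(6) b' by (simp add: T_def T'_def)
  have cT: "c \<in> T" and cT': "c' \<in> T'"
    using vmin_vertex(1)[OF m w] vmin_vertex(1)[OF m' w'] by (auto simp: T_def T'_def c_def c'_def)
  have pos: "pos M' (f x) = pos M x" if "x \<in> half_edges M" for x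
    using rooted_map_iso_pos[OF f M M' that] .
  have cM: "c \<in> half_edges M" using cT T_sub by auto
  obtain x where x: "x \<in> T" "c' = f x" using fT cT' by blast
  have xM: "x \<in> half_edges M" using x(1) T_sub by auto
  \<comment> \<open>\<open>f c\<close> and \<open>c'\<close> both lie in \<open>T'\<close> after
    \<open>b'\<close>; minimality of \<open>c'\<close> gives this inequality, that of
    \<open>c\<close> the reverse one.\<close>
  have "pos M' c' \<le> pos M' (f c)"
    using G'(8)[of "f c"] fT cT G(7) pos[OF cM] pos[OF bM] b' by (auto simp: T'_def)
  moreover have "pos M c \<le> pos M x"
    using G(8)[of x] x G'(7) pos[OF xM] pos[OF bM] b' by (auto simp: T_def)
  ultimately have "pos M' (f c) = pos M' (f x)" using pos[OF cM] pos[OF xM] x(2) by simp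
  then have fc: "f c = c'"
    using pos_eq_iff[OF M' rooted_map_iso_in[OF f cM] rooted_map_iso_in[OF f xM]] x(2) by simp
  have "glue M a b c = m" "glue M' a' b' c' = m'"
    unfolding M_def M'_def using G(4,11,12) G'(4,11,12) by (auto intro!: glue_glue)
  then show fm: "rooted_map_iso f m m'"
    using rooted_map_iso_glue[OF f, of a b c] G(9) cM bM HM fa fc b' by simp
  show "f ` v = v'"
    using rooted_map_iso_vertex_of[OF fm m G(9)] fa vmin_vertex(4)[OF m v] vmin_vertex(4)[OF m' v']
    by (simp add: a_def a'_def)
  show "f ` w = w'"
    using rooted_map_iso_vertex_of[OF fm m G(10)] fc vmin_vertex(4)[OF m w] vmin_vertex(4)[OF m' w']
    by (simp add: c_def c'_def)
qed

lemma gluable_append: "gluable n m (xs @ ys) b \<Longrightarrow> gluable n m xs b"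
  by (auto simp: gluable_def sorted_wrt_append)

lemma even_length_split:
  assumes "even (length xs)" "xs \<noteq> []"
  obtains ys w v where "xs = ys @ [w, v]" "even (length ys)"
proof -
  obtain zs v where xs: "xs = zs @ [v]" using assms(2) by (metis rev_exhaust)
  then have "zs \<noteq> []" using assms(1) by auto
  then obtain ys w where "zs = ys @ [w]" by (metis rev_exhaust)
  then show ?thesis using xs assms(1) that by simp
qed

text \<open>The lists are peeled from the end, since the latest gluing is the one that can be read
  off the result. \<open>b\<close> is the minimum of its vertex exactly when no pair is left, and
  \<open>f\<close> preserves this property, so both lists run out together.\<close>

lemma rooted_map_iso_unglue_pairs:
  assumes "gluable n m us b" "even (length us)" "b = vmin m (vertex_of m b)"
    and "gluable n m' us' b'" "even (length us')" "b' = vmin m' (vertex_of m' b')"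
    and "rooted_map_iso f (glue_pairs m us b) (glue_pairs m' us' b')" "f b = b'"
  shows "rooted_map_iso f m m' \<and> map ((`) f) us = us'"
  using assms(1,2,4,5,7)
proof (induction "length us" arbitrary: us us' rule: less_induct)
  case less
  note gl = less.prems(1) and ev = less.prems(2) and gl' = less.prems(3) and ev' = less.prems(4)
  define M M' where "M = glue_pairs m us b" and "M' = glue_pairs m' us' b'"
  have f: "rooted_map_iso f M M'" using less.prems(5) by (simp add: M_def M'_def)
  note P = glue_pairs_gluable[of n m us "[]" b, folded M_def]
    and P' = glue_pairs_gluable[of n m' us' "[]" b', folded M'_def]
  have M: "unicellular n M" and M': "unicellular n M'" and bM: "b \<in> half_edges M"
    using P P' gl ev gl' ev' by (auto simp: gluable_def desc_at_def)
  have nonmin: "b = vmin M (vertex_of M b) \<longleftrightarrow> us = []" "b' = vmin M' (vertex_of M' b') \<longleftrightarrow> us' = []"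
    using P P' gl ev gl' ev' assms(3,6) by (auto simp: M_def M'_def)
  have "vmin M (vertex_of M b) \<in> half_edges M"
    using vmin_vertex(3)[OF M vertex_in_vertices[OF bM]] .
  moreover have "f (vmin M (vertex_of M b)) = vmin M' (vertex_of M' b')"
    using rooted_map_iso_vmin[OF f M M' vertex_in_vertices[OF bM]]
      rooted_map_iso_vertex_of[OF f M bM] assms(8) by simp
  ultimately have iff: "us = [] \<longleftrightarrow> us' = []"
    using nonmin rooted_map_iso_eq_iff[OF f bM, of "vmin M (vertex_of M b)"] assms(8) by auto
  show ?case
  proof (cases "us = []")
    case True
    then show ?thesis using iff f by (simp add: M_def M'_def)
  next
    case False
    then have "us' \<noteq> []" using iff by simp
    obtain xs w v where xs: "us = xs @ [w, v]" "even (length xs)"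
      using even_length_split[OF ev False] by blast
    obtain xs' w' v' where xs': "us' = xs' @ [w', v']" "even (length xs')"
      using even_length_split[OF ev' \<open>us' \<noteq> []\<close>] by blast
    let ?N = "glue_pairs m xs b" and ?N' = "glue_pairs m' xs' b'"
    have N: "gluable n ?N [w, v] b" "gluable n ?N' [w', v'] b'"
      using glue_pairs_gluable[of n m xs "[w, v]" b] glue_pairs_gluable[of n m' xs' "[w', v']" b']
        gl gl' xs xs' by auto
    have "rooted_map_iso f (glue ?N (vmin ?N v) (vmin ?N w) b) (glue ?N' (vmin ?N' v') (vmin ?N' w') b')"
      using f xs xs' by (simp add: M_def M'_def glue_pairs_append)
    note un = rooted_map_iso_unglue[OF N this assms(8)]
    have "rooted_map_iso f m m' \<and> map ((`) f) xs = xs'"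
    proof (rule less.hyps)
      show "length xs < length us" using xs by simp
      show "gluable n m xs b" "gluable n m' xs' b'" using gl gl' xs xs' gluable_append by metis+
    qed (use xs xs' un in auto)
    then show ?thesis using xs xs' un by simp
  qed
qed

section \<open>The map \<open>\<Lambda>\<close>\<close>

lemma inj_on_pos_vmin:
  assumes m: "unicellular n m"
  shows "inj_on (\<lambda>v. pos m (vmin m v)) (vertices m)"
proof (rule inj_onI)
  fix v w assume vw: "v \<in> vertices m" "w \<in> vertices m" "pos m (vmin m v) = pos m (vmin m w)"
  then have "vmin m v = vmin m w"
    using pos_eq_iff[OF m] vmin_vertex(3)[OF m vw(1)] vmin_vertex(3)[OF m vw(2)] by blast
  then show "v = w" using vmin_vertex(4)[OF m vw(1)] vmin_vertex(4)[OF m vw(2)] by metis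
qed

text \<open>Resolves the \<open>THE\<close> of \<open>sorted_vertices\<close>: positions of minima
  increase strictly along such a list, and they determine the vertices.\<close>

lemma sorted_vertices_eqI:
  assumes m: "unicellular n m" and vs: "set vs \<subseteq> vertices m" and sorted: "sorted_wrt (vertex_less m) vs"
  shows "sorted_vertices m (set vs) = vs"
  unfolding sorted_vertices_def
proof (rule the_equality)
  let ?k = "\<lambda>v. pos m (vmin m v)"
  have strict: "sorted_wrt (<) (map ?k ws)" if ws: "sorted_wrt (vertex_less m) ws" "set ws = set vs" for ws
    unfolding sorted_wrt_map
  proof (rule sorted_wrt_mono_rel[OF _ ws(1)])
    fix x y assume "x \<in> set ws" "y \<in> set ws" "vertex_less m x y"
    then show "?k x < ?k y" using vertex_less_iff_pos[OF m, of x y] vs ws(2) by auto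
  qed
  note inj = inj_on_pos_vmin[OF m]
  show "sorted_wrt (vertex_less m) vs \<and> set vs = set vs" using sorted by simp
  fix ws assume ws: "sorted_wrt (vertex_less m) ws \<and> set ws = set vs"
  have "map ?k ws = map ?k vs"
    by (rule strict_sorted_equal) (use ws sorted strict in auto)
  then show "ws = vs"
    by (rule map_inj_on) (use ws vs inj in \<open>auto intro: inj_on_subset\<close>)
qed

lemma sorted_list_of_vertices_exists:
  assumes m: "unicellular n m" and S: "S \<subseteq> vertices m"
  obtains vs where "sorted_wrt (vertex_less m) vs" "set vs = S" "length vs = card S"
proof -
  let ?k = "\<lambda>v. pos m (vmin m v)"
  let ?g = "inv_into S ?k"
  let ?l = "sorted_list_of_set (?k ` S)"
  have fin: "finite S" using finite_subset[OF S finite_vertices[OF m]] .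
  have inj: "inj_on ?k S" using inj_on_subset[OF inj_on_pos_vmin[OF m] S] .
  have g: "?g i \<in> S" "?k (?g i) = i" if "i \<in> ?k ` S" for i
    using that by (rule inv_into_into, rule f_inv_into_f)
  have "sorted_wrt (vertex_less m) (map ?g ?l)"
    unfolding sorted_wrt_map
  proof (rule sorted_wrt_mono_rel)
    show "sorted_wrt (<) ?l" by simp
    fix x y assume "x \<in> set ?l" "y \<in> set ?l" "x < y"
    then show "vertex_less m (?g x) (?g y)"
      using vertex_less_iff_pos[OF m, of "?g x" "?g y"] g[of x] g[of y] S fin by auto
  qed
  moreover have "set (map ?g ?l) = S"
    using fin inj by (simp add: inv_into_image_cancel)
  moreover have "length (map ?g ?l) = card S" using card_image[OF inj] by simp
  ultimately show ?thesis using that by blast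
qed

text \<open>The largest marked vertex supplies the third point of \<Phi>: \<open>b\<close> is its
  minimum, and \<open>desc_at\<close> holds because the \<sigma>-predecessor of a minimum lies in
  the same vertex. The other \<open>k\<close> vertices form the list.\<close>

lemma marked_vertices_gluable:
  assumes m: "unicellular n m" and S: "S \<subseteq> vertices m" and card: "card S = Suc k"
  obtains us b where "gluable n m us b" "b = vmin m (vertex_of m b)"
    "S = insert (vertex_of m b) (set us)" "length us = k"
proof -
  obtain vs where vs: "sorted_wrt (vertex_less m) vs" "set vs = S" "length vs = card S"
    using sorted_list_of_vertices_exists[OF m S] by blast
  then obtain us V where us: "rev vs = V # us"
    using card by (cases "rev vs") auto
  have vs_eq: "vs = rev (V # us)" using us by (metis rev_rev_ident)
  define b where "b = vmin m V"
  have V: "V \<in> vertices m" using vs(2) vs_eq S by auto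
  note vV = vmin_vertex[OF m V, folded b_def]
  have "desc_at m b"
  proof -
    define h where "h = inv (vertex_perm m) b"
    have sh: "vertex_perm m h = b"
      unfolding h_def using permutes_inverses(1)[OF unicellular_vertex_permutes[OF m]] .
    then have "vertex_of m h = V" using vertex_of_perm[OF m, of h] vV(4) by simp
    then have "h \<in> V" using vertex_of_self[OF m, of h] by simp
    then have "h \<in> half_edges m" "pos m b \<le> pos m h" using vertices_subset[OF m V] vV(2) by auto
    then show ?thesis using sh vV(3) by (auto simp: desc_at_def)
  qed
  moreover have "sorted_wrt (\<lambda>v w. vertex_less m w v) (V # us)"
    using vs(1) unfolding vs_eq sorted_wrt_rev .
  moreover have "set us \<subseteq> vertices m" using vs(2) vs_eq S by auto
  ultimately have "gluable n m us b" using m vV(4) by (simp add: gluable_def)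
  moreover have "b = vmin m (vertex_of m b)" unfolding vV(4) by (rule b_def)
  moreover have "S = insert (vertex_of m b) (set us)" using vs(2) vs_eq vV(4) by auto
  moreover have "length us = k" using vs(3) vs_eq card by simp
  ultimately show ?thesis using that by blast
qed

lemma gluable_sorted_vertices:
  assumes gl: "gluable n m us b"
  shows "sorted_vertices m (insert (vertex_of m b) (set us)) = rev (vertex_of m b # us)"
    and "card (insert (vertex_of m b) (set us)) = Suc (length us)"
proof -
  let ?vs = "rev (vertex_of m b # us)"
  have m: "unicellular n m" using gl by (rule gluable_unicellular)
  have sub: "set ?vs \<subseteq> vertices m"
    using gl vertex_in_vertices[OF gluable_half_edge[OF gl]] by (simp add: gluable_def)
  have sorted: "sorted_wrt (vertex_less m) ?vs"
    using gl unfolding sorted_wrt_rev by (simp add: gluable_def)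
  have set_vs: "set ?vs = insert (vertex_of m b) (set us)" by simp
  show eq: "sorted_vertices m (insert (vertex_of m b) (set us)) = ?vs"
    using sorted_vertices_eqI[OF m sub sorted] unfolding set_vs .
  obtain ws where ws: "sorted_wrt (vertex_less m) ws" "set ws = set ?vs" "length ws = card (set ?vs)"
    using sorted_list_of_vertices_exists[OF m sub] by blast
  have "ws = ?vs"
    using sorted_vertices_eqI[OF m, of ws] sorted_vertices_eqI[OF m sub sorted] ws sub by metis
  then show "card (insert (vertex_of m b) (set us)) = Suc (length us)" using ws(3) by simp
qed

section \<open>The steps of \<Lambda> as iterated gluing\<close>

lemma glue_pairs_take_step:
  assumes "2 * i + 1 < length us"
  shows "glue_pairs m (take (2 * Suc i) us) b =
    (let M = glue_pairs m (take (2 * i) us) b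
     in glue M (vmin M (us ! (2 * i + 1))) (vmin M (us ! (2 * i))) b)"
proof -
  have "take (2 * Suc i) us = take (2 * i) us @ [us ! (2 * i), us ! (2 * i + 1)]"
    using assms by (simp add: take_Suc_conv_app_nth)
  moreover have "even (length (take (2 * i) us))" using assms by simp
  ultimately show ?thesis by (simp add: glue_pairs_append Let_def)
qed

text \<open>\<open>v\<close> counts upwards from 1, while \<open>us\<close> runs downwards from the
  second largest vertex, whence \<open>2 * q - t\<close>. \<Lambda> hands the trisection on
  unchanged, whereas the right-hand side reads it off each map anew as the predecessor of
  \<open>b\<close>; they agree because no \<Psi>-step changes that predecessor.\<close>

lemma Lambda_seq_eq_glue_pairs:
  assumes gl: "gluable n m us b" and b: "b = vmin m (vertex_of m b)" and len: "length us = 2 * q"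
    and top: "v (2 * q + 1) = vertex_of m b" and v: "\<And>t. t < 2 * q \<Longrightarrow> v (2 * q - t) = us ! t"
    and i: "i < q"
  shows "Lambda_seq m v q i = (glue_pairs m (take (2 * Suc i) us) b,
    inv (vertex_perm (glue_pairs m (take (2 * Suc i) us) b)) b)"
  using i
proof (induction i)
  case 0
  have "glue_pairs m (take (2 * Suc 0) us) b = glue m (vmin m (us ! 1)) (vmin m (us ! 0)) b"
    using glue_pairs_take_step[of 0 us m b] 0 len by (simp add: Let_def)
  moreover have "v (2 * q) = us ! 0" "v (2 * q - 1) = us ! 1" using v[of 0] v[of 1] 0 by auto
  ultimately show ?case unfolding Lambda_seq.simps Phi_def Let_def top b[symmetric]
    by (simp del: glue_simps)
next
  case (Suc i)
  define M where "M = glue_pairs m (take (2 * Suc i) us) b"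
  define w u where "w = us ! (2 * Suc i)" and "u = us ! (2 * Suc i + 1)"
  define M' where "M' = glue_pairs m (take (2 * Suc (Suc i)) us) b"
  have less: "2 * Suc i + 1 < length us" using Suc.prems len by simp
  have M': "M' = glue M (vmin M u) (vmin M w) b"
    unfolding M'_def M_def u_def w_def using glue_pairs_take_step[OF less] by (simp add: Let_def)
  have drop: "drop (2 * Suc i) us = w # u # drop (2 * Suc (Suc i)) us"
  proof -
    have "drop (2 * Suc i) us = w # drop (Suc (2 * Suc i)) us"
      unfolding w_def using less by (intro Cons_nth_drop_Suc[symmetric]) simp
    also have "drop (Suc (2 * Suc i)) us = u # drop (Suc (Suc (2 * Suc i))) us"
      unfolding u_def using less Cons_nth_drop_Suc[of "Suc (2 * Suc i)" us] by simp
    finally show ?thesis by simp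
  qed
  have split: "gluable n m (take (2 * Suc i) us @ drop (2 * Suc i) us) b" using gl by simp
  have P: "gluable n M (w # u # drop (2 * Suc (Suc i)) us) b" "b \<noteq> vmin M (vertex_of M b)"
    using glue_pairs_gluable[OF split] less unfolding drop M_def by auto
  define \<tau> where "\<tau> = inv (vertex_perm M) b"
  have uM: "unicellular n M" and bM: "b \<in> half_edges M"
    by (rule gluable_unicellular[OF P(1)], rule gluable_half_edge[OF P(1)])
  have \<tau>: "vertex_perm M \<tau> = b"
    unfolding \<tau>_def using permutes_inverses(1)[OF unicellular_vertex_permutes[OF uM]] .
  \<comment> \<open>After at least one gluing \<open>b\<close> is not alone in its vertex. Before
    \<Phi> it may be, but \<Phi> takes the predecessor only in the glued map.\<close>
  have "\<tau> \<noteq> b" using \<tau> not_vmin_vertex_perm_neq[OF uM bM P(2)] by auto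
  then have "vertex_perm M' \<tau> = b" unfolding M' using glue_gluable(13)[OF P(1) \<tau>] by simp
  moreover have "unicellular n M'" unfolding M' using gluable_unicellular[OF glue_gluable(1)[OF P(1)]] .
  ultimately have \<tau>': "inv (vertex_perm M') b = \<tau>"
    using permutes_inverses(2)[OF unicellular_vertex_permutes] by metis
  have "Lambda_seq m v q i = (M, \<tau>)" using Suc unfolding M_def \<tau>_def by simp
  moreover have "v (2 * q - 2 * Suc i - 1) = u" "v (2 * q - 2 * Suc i) = w"
    using v[of "2 * Suc i"] v[of "2 * Suc i + 1"] less len by (auto simp: u_def w_def)
  ultimately have "Lambda_seq m v q (Suc i) = Psi M u w \<tau>" by (simp del: mult_Suc_right)
  also have "\<dots> = (M', \<tau>)" unfolding Psi_def \<tau> M' ..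
  finally show ?case unfolding M'_def[symmetric] \<tau>' .
qed

lemma Lambda_rep_eq_glue_pairs:
  assumes gl: "gluable n m us b" and b: "b = vmin m (vertex_of m b)" and len: "length us = 2 * q"
    and q: "q \<ge> 1"
  shows "Lambda_rep (m, insert (vertex_of m b) (set us)) =
    (glue_pairs m us b, inv (vertex_perm (glue_pairs m us b)) b)"
proof -
  let ?S = "insert (vertex_of m b) (set us)"
  let ?v = "\<lambda>j. rev (vertex_of m b # us) ! (j - 1)"
  have "(card ?S - 1) div 2 = q" using gluable_sorted_vertices(2)[OF gl] len by simp
  then have "Lambda_rep (m, ?S) = Lambda_seq m ?v q (q - 1)"
    unfolding Lambda_rep_def using gluable_sorted_vertices(1)[OF gl] by (simp add: Let_def)
  also have "\<dots> = (glue_pairs m (take (2 * Suc (q - 1)) us) b,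
      inv (vertex_perm (glue_pairs m (take (2 * Suc (q - 1)) us) b)) b)"
  proof (rule Lambda_seq_eq_glue_pairs[OF gl b len])
    show "rev (vertex_of m b # us) ! (2 * q + 1 - 1) = vertex_of m b" using len by (simp add: nth_append)
    show "rev (vertex_of m b # us) ! (2 * q - t - 1) = us ! t" if "t < 2 * q" for t
      using that len by (simp add: nth_append rev_nth)
    show "q - 1 < q" using q by simp
  qed
  also have "take (2 * Suc (q - 1)) us = us" using len q by simp
  finally show ?thesis .
qed

text \<open>\<open>\<tau>\<close> is the only \<sigma>-preimage of \<open>b\<close> and lies in the
  same vertex, so the existential in \<open>desc_at\<close> speaks about \<open>\<tau>\<close>
  alone.\<close>

lemma trisection_iff:
  assumes m: "unicellular n m" and \<tau>: "\<tau> = inv (vertex_perm m) b" and b: "b \<in> half_edges m"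
  shows "trisection m \<tau> \<longleftrightarrow> desc_at m b \<and> b \<noteq> vmin m (vertex_of m b)"
proof -
  note perm = unicellular_vertex_permutes[OF m]
  have s\<tau>: "vertex_perm m \<tau> = b" unfolding \<tau> using permutes_inverses(1)[OF perm] .
  have \<tau>H: "\<tau> \<in> half_edges m" using permutes_in_image[OF perm, of \<tau>] s\<tau> b by simp
  have "vertex_of m \<tau> = vertex_of m b" using vertex_of_perm[OF m, of \<tau>] s\<tau> by simp
  moreover have "desc_at m b \<longleftrightarrow> pos m b \<le> pos m \<tau>"
    unfolding desc_at_def using b s\<tau> \<tau>H permutes_inverses(2)[OF perm] \<tau> by auto
  ultimately show ?thesis
    unfolding trisection_def s\<tau> using he_le_iff_pos[OF m b \<tau>H] \<tau>H by simp
qed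

section \<open>Isomorphism as an equivalence relation on marked maps\<close>

lemma rooted_map_iso_refl: "rooted_map_iso id m m"
  by (simp add: rooted_map_iso_def)

lemma rooted_map_iso_sym:
  assumes f: "rooted_map_iso f m m'" and m: "unicellular n m"
  shows "rooted_map_iso (inv_into (half_edges m) f) m' m"
proof -
  let ?g = "inv_into (half_edges m) f"
  note bij = rooted_map_iso_bij[OF f]
  have gf: "?g (f x) = x" if "x \<in> half_edges m" for x
    using bij_betw_inv_into_left[OF bij that] .
  have ex: "\<exists>x\<in>half_edges m. h = f x" if "h \<in> half_edges m'" for h
    using bij that unfolding bij_betw_def by blast
  have "?g (edge_inv m' h) = edge_inv m (?g h) \<and> ?g (vertex_perm m' h) = vertex_perm m (?g h)"
    if h: "h \<in> half_edges m'" for h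
  proof -
    obtain x where x: "x \<in> half_edges m" "h = f x" using ex[OF h] by blast
    have "edge_inv m x \<in> half_edges m" "vertex_perm m x \<in> half_edges m"
      using x(1) permutes_in_image[OF unicellular_edge_permutes[OF m]]
        permutes_in_image[OF unicellular_vertex_permutes[OF m]] by auto
    then show ?thesis
      using gf x rooted_map_iso_edge[OF f x(1)] rooted_map_iso_vertex[OF f x(1)] by metis
  qed
  moreover have "?g (root_he m') = root_he m"
    using gf[OF unicellular_root[OF m]] rooted_map_iso_root[OF f] by simp
  ultimately show ?thesis
    unfolding rooted_map_iso_def using bij_betw_inv_into[OF bij] by blast
qed

lemma rooted_map_iso_trans:
  assumes "rooted_map_iso f m m'" "rooted_map_iso g m' m''"
  shows "rooted_map_iso (g \<circ> f) m m''"
  using assms rooted_map_iso_in[OF assms(1)] bij_betw_trans[of f "half_edges m" "half_edges m'" g]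
  unfolding rooted_map_iso_def by simp

lemma equiv_D_iso: "equiv {(m, \<tau>). unicellular n m \<and> \<tau> \<in> half_edges m} (D_iso n)"
proof (rule equivI)
  show "D_iso n \<subseteq> {(m, \<tau>). unicellular n m \<and> \<tau> \<in> half_edges m} \<times> {(m, \<tau>). unicellular n m \<and> \<tau> \<in> half_edges m}"
    by (auto simp: D_iso_def)
  show "refl_on {(m, \<tau>). unicellular n m \<and> \<tau> \<in> half_edges m} (D_iso n)"
    by (rule refl_onI) (auto simp: D_iso_def intro!: exI[of _ id] rooted_map_iso_refl)
  show "sym (D_iso n)"
  proof (rule symI)
    fix x y assume "(x, y) \<in> D_iso n"
    then obtain m \<tau> m' f where xy: "x = (m, \<tau>)" "y = (m', f \<tau>)" "unicellular n m" "\<tau> \<in> half_edges m"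
      "unicellular n m'" "f \<tau> \<in> half_edges m'" "rooted_map_iso f m m'"
      by (auto simp: D_iso_def)
    have "inv_into (half_edges m) f (f \<tau>) = \<tau>"
      using bij_betw_inv_into_left[OF rooted_map_iso_bij[OF xy(7)] xy(4)] .
    then show "(y, x) \<in> D_iso n"
      using xy rooted_map_iso_sym[OF xy(7,3)] by (auto simp: D_iso_def)
  qed
  show "trans (D_iso n)"
  proof (rule transI)
    fix x y z assume "(x, y) \<in> D_iso n" "(y, z) \<in> D_iso n"
    then obtain m \<tau> m' f m'' g where "x = (m, \<tau>)" "y = (m', f \<tau>)" "z = (m'', g (f \<tau>))"
      "unicellular n m" "\<tau> \<in> half_edges m" "unicellular n m''" "g (f \<tau>) \<in> half_edges m''"
      "rooted_map_iso f m m'" "rooted_map_iso g m' m''"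
      by (auto simp: D_iso_def)
    then show "(x, z) \<in> D_iso n"
      using rooted_map_iso_trans[of f m m' g m''] by (auto simp: D_iso_def intro!: exI[of _ "g \<circ> f"])
  qed
qed

lemma equiv_U_iso: "equiv {(m, S). unicellular n m \<and> S \<subseteq> vertices m} (U_iso n)"
proof (rule equivI)
  show "U_iso n \<subseteq> {(m, S). unicellular n m \<and> S \<subseteq> vertices m} \<times> {(m, S). unicellular n m \<and> S \<subseteq> vertices m}"
    by (auto simp: U_iso_def)
  show "refl_on {(m, S). unicellular n m \<and> S \<subseteq> vertices m} (U_iso n)"
    by (rule refl_onI) (auto simp: U_iso_def intro!: exI[of _ id] rooted_map_iso_refl)
  show "sym (U_iso n)"
  proof (rule symI)
    fix x y assume "(x, y) \<in> U_iso n"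
    then obtain m S m' f where xy: "x = (m, S)" "y = (m', (`) f ` S)" "unicellular n m" "S \<subseteq> vertices m"
      "unicellular n m'" "(`) f ` S \<subseteq> vertices m'" "rooted_map_iso f m m'"
      by (auto simp: U_iso_def)
    let ?g = "inv_into (half_edges m) f"
    have "?g ` f ` v = v" if "v \<in> S" for v
      using that xy(4) vertices_subset[OF xy(3)]
      by (intro inv_into_image_cancel[OF bij_betw_imp_inj_on[OF rooted_map_iso_bij[OF xy(7)]]]) blast
    then have "(`) ?g ` (`) f ` S = S" by (force simp: image_image)
    then show "(y, x) \<in> U_iso n"
      using xy rooted_map_iso_sym[OF xy(7,3)] by (auto simp: U_iso_def)
  qed
  show "trans (U_iso n)"
  proof (rule transI)
    fix x y z assume "(x, y) \<in> U_iso n" "(y, z) \<in> U_iso n"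
    then obtain m S m' f m'' g where "x = (m, S)" "z = (m'', (`) g ` (`) f ` S)"
      "unicellular n m" "S \<subseteq> vertices m" "unicellular n m''" "(`) g ` (`) f ` S \<subseteq> vertices m''"
      "rooted_map_iso f m m'" "rooted_map_iso g m' m''"
      by (auto simp: U_iso_def)
    moreover have "(`) (g \<circ> f) ` S = (`) g ` (`) f ` S" by (simp add: image_comp comp_def)
    ultimately show "(x, z) \<in> U_iso n"
      using rooted_map_iso_trans[of f m m' g m''] unfolding U_iso_def by blast
  qed
qed

section \<open>\<Lambda> on representatives\<close>

lemma Lambda_rep_in_D_rep:
  assumes p: "p \<le> g - 1" and g: "g \<ge> 1" and x: "x \<in> U_rep (2*g - 2*p + 1) p n"
  shows "Lambda_rep x \<in> D_rep g n"
proof -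
  obtain m S where mS: "x = (m, S)" "unicellular n m" "has_genus n p m" "S \<subseteq> vertices m"
    "card S = Suc (2 * (g - p))"
    using x p by (auto simp: U_rep_def)
  obtain us b where us: "gluable n m us b" "b = vmin m (vertex_of m b)"
    "S = insert (vertex_of m b) (set us)" "length us = 2 * (g - p)"
    using marked_vertices_gluable[OF mS(2,4,5)] by blast
  define M where "M = glue_pairs m us b"
  have q: "g - p \<ge> 1" using p g by simp
  have L: "Lambda_rep x = (M, inv (vertex_perm M) b)"
    using Lambda_rep_eq_glue_pairs[OF us(1,2,4) q] mS(1) us(3) by (simp add: M_def)
  have "us \<noteq> []" using us(4) q by auto
  then have M: "gluable n M [] b" "card (vertices M) + length us = card (vertices m)"
    "b \<noteq> vmin M (vertex_of M b)"
    using glue_pairs_gluable[of n m us "[]" b] us(1,4) by (auto simp: M_def)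
  \<comment> \<open>There are \<open>g - p\<close> gluings, each removing two vertices and so
    raising the genus by one.\<close>
  have "has_genus n g M" using mS(3) M(2) us(4) p g unfolding has_genus_def by linarith
  moreover have "trisection M (inv (vertex_perm M) b)"
    using trisection_iff[OF gluable_unicellular[OF M(1)] refl gluable_half_edge[OF M(1)]] M
    by (simp add: gluable_def)
  ultimately show ?thesis using L gluable_unicellular[OF M(1)] by (simp add: D_rep_def)
qed

text \<open>An isomorphism of marked maps respects the vertex order, so it carries one sorted list
  to the other. It remains an isomorphism after gluing and commutes with taking the predecessor of
  \<open>b\<close>.\<close>

lemma Lambda_rep_iso:
  assumes k: "k \<ge> 1" and x: "x \<in> U_rep (2 * k + 1) p n" and xy: "(x, y) \<in> U_iso n"
  shows "(Lambda_rep x, Lambda_rep y) \<in> D_iso n"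
proof -
  obtain m S m' f where mS: "x = (m, S)" "y = (m', (`) f ` S)" "unicellular n m" "S \<subseteq> vertices m"
    "unicellular n m'" "rooted_map_iso f m m'"
    using xy by (auto simp: U_iso_def)
  note f = mS(6) and m = mS(3) and m' = mS(5)
  have card: "card S = Suc (2 * k)" using x mS(1) by (simp add: U_rep_def)
  obtain us b where us: "gluable n m us b" "b = vmin m (vertex_of m b)"
    "S = insert (vertex_of m b) (set us)" "length us = 2 * k"
    using marked_vertices_gluable[OF m mS(4) card] by blast
  have b: "b \<in> half_edges m" using us(1) by (rule gluable_half_edge)
  let ?us = "map ((`) f) us"
  note vb = rooted_map_iso_vertex_of[OF f m b]
  have us': "gluable n m' ?us (f b)" using rooted_map_iso_gluable[OF f us(1) m'] .
  have b': "f b = vmin m' (vertex_of m' (f b))"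
    using rooted_map_iso_vmin[OF f m m' vertex_in_vertices[OF b]] us(2) vb by simp
  have S': "(`) f ` S = insert (vertex_of m' (f b)) (set ?us)" unfolding us(3) using vb by simp
  define M M' where "M = glue_pairs m us b" and "M' = glue_pairs m' ?us (f b)"
  have L: "Lambda_rep x = (M, inv (vertex_perm M) b)"
    using Lambda_rep_eq_glue_pairs[OF us(1,2,4) k] mS(1) us(3) by (simp add: M_def)
  have L': "Lambda_rep y = (M', inv (vertex_perm M') (f b))"
    using Lambda_rep_eq_glue_pairs[OF us' b' _ k] mS(2) S' us(4) by (simp add: M'_def)
  have fM: "rooted_map_iso f M M'"
    unfolding M_def M'_def by (rule rooted_map_iso_glue_pairs[OF f us(1) m'])
  have M: "unicellular n M" and M': "unicellular n M'"
    using glue_pairs_gluable[of n m us "[]" b] glue_pairs_gluable[of n m' ?us "[]" "f b"] us us'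
    by (auto simp: M_def M'_def gluable_def)
  note perm = unicellular_vertex_permutes[OF M] and perm' = unicellular_vertex_permutes[OF M']
  let ?\<tau> = "inv (vertex_perm M) b"
  have \<tau>: "?\<tau> \<in> half_edges M" using permutes_in_image[OF permutes_inv[OF perm]] b by (simp add: M_def)
  have "vertex_perm M' (f ?\<tau>) = f b"
    using rooted_map_iso_vertex[OF fM \<tau>] permutes_inverses(1)[OF perm] by simp
  then have "f ?\<tau> = inv (vertex_perm M') (f b)" using permutes_inverses(2)[OF perm'] by metis
  then show ?thesis
    unfolding L L' D_iso_def using M M' \<tau> rooted_map_iso_in[OF fM \<tau>] fM by auto
qed

text \<open>Injectivity across all genera at once: the number of marked vertices is recovered from
  the length of the list.\<close>

lemma Lambda_rep_iso_reflects:
  assumes k: "k \<ge> 1" and x: "x \<in> U_rep (2 * k + 1) p n"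
    and k': "k' \<ge> 1" and y: "y \<in> U_rep (2 * k' + 1) p' n"
    and xy: "(Lambda_rep x, Lambda_rep y) \<in> D_iso n"
  shows "k = k'" and "(x, y) \<in> U_iso n"
proof -
  obtain m S where mS: "x = (m, S)" "unicellular n m" "S \<subseteq> vertices m" "card S = Suc (2 * k)"
    using x by (auto simp: U_rep_def)
  obtain m' S' where mS': "y = (m', S')" "unicellular n m'" "S' \<subseteq> vertices m'" "card S' = Suc (2 * k')"
    using y by (auto simp: U_rep_def)
  obtain us b where us: "gluable n m us b" "b = vmin m (vertex_of m b)"
    "S = insert (vertex_of m b) (set us)" "length us = 2 * k"
    using marked_vertices_gluable[OF mS(2-4)] by blast
  obtain us' b' where us': "gluable n m' us' b'" "b' = vmin m' (vertex_of m' b')"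
    "S' = insert (vertex_of m' b') (set us')" "length us' = 2 * k'"
    using marked_vertices_gluable[OF mS'(2-4)] by blast
  define M M' where "M = glue_pairs m us b" and "M' = glue_pairs m' us' b'"
  have L: "Lambda_rep x = (M, inv (vertex_perm M) b)"
    using Lambda_rep_eq_glue_pairs[OF us(1,2,4) k] mS(1) us(3) by (simp add: M_def)
  have L': "Lambda_rep y = (M', inv (vertex_perm M') b')"
    using Lambda_rep_eq_glue_pairs[OF us'(1,2,4) k'] mS'(1) us'(3) by (simp add: M'_def)
  obtain f where f: "rooted_map_iso f M M'" "f (inv (vertex_perm M) b) = inv (vertex_perm M') b'"
    and M: "unicellular n M" "inv (vertex_perm M) b \<in> half_edges M" "unicellular n M'"
    using xy unfolding L L' D_iso_def by auto
  have "f b = b'"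
    using rooted_map_iso_vertex[OF f(1) M(2)] f(2)
      permutes_inverses(1)[OF unicellular_vertex_permutes[OF M(1)]]
      permutes_inverses(1)[OF unicellular_vertex_permutes[OF M(3)]] by simp
  then have iso: "rooted_map_iso f m m'" "map ((`) f) us = us'"
    using rooted_map_iso_unglue_pairs[OF us(1) _ us(2) us'(1) _ us'(2) f(1)[unfolded M_def M'_def]]
      us(4) us'(4) by auto
  have "length us = length us'" unfolding iso(2)[symmetric] by simp
  then show "k = k'" using us(4) us'(4) by simp
  have "(`) f ` S = S'"
    unfolding us(3) us'(3) iso(2)[symmetric]
    using rooted_map_iso_vertex_of[OF iso(1) mS(2) gluable_half_edge[OF us(1)]] \<open>f b = b'\<close> by simp
  then show "(x, y) \<in> U_iso n" using mS mS' iso(1) by (auto simp: U_iso_def)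
qed

text \<open>The genus is read off from the slicing: if it takes \<open>q\<close> steps, then
  \<open>p = g - q\<close>.\<close>

lemma Lambda_rep_surj:
  assumes y: "y \<in> D_rep g n"
  obtains p x where "p < g" "x \<in> U_rep (2*g - 2*p + 1) p n" "Lambda_rep x = y"
proof -
  obtain M \<tau> where M: "y = (M, \<tau>)" "unicellular n M" "has_genus n g M" "trisection M \<tau>"
    using y by (auto simp: D_rep_def)
  note perm = unicellular_vertex_permutes[OF M(2)]
  define b where "b = vertex_perm M \<tau>"
  have \<tau>: "\<tau> = inv (vertex_perm M) b" unfolding b_def using permutes_inverses(2)[OF perm] by simp
  have b: "b \<in> half_edges M"
    using M(4) permutes_in_image[OF perm] by (simp add: b_def trisection_def)
  have desc: "desc_at M b" "b \<noteq> vmin M (vertex_of M b)"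
    using trisection_iff[OF M(2) \<tau> b] M(4) by auto
  then have "gluable n M [] b" using M(2) by (simp add: gluable_def)
  then obtain m us where us: "gluable n m us b" "even (length us)" "b = vmin m (vertex_of m b)"
    "M = glue_pairs m us b"
    using gluable_slice_completely[of n M "[]" b] by auto
  obtain q where q: "length us = 2 * q" using us(2) by (elim evenE)
  have "us \<noteq> []" using us(3,4) desc(2) by auto
  then have "q \<ge> 1" using q by (cases q) auto
  have m: "unicellular n m" using us(1) by (rule gluable_unicellular)
  have card: "card (vertices M) + 2 * q = card (vertices m)"
    using glue_pairs_gluable[of n m us "[]" b] us q by simp
  \<comment> \<open>Slicing added \<open>2 * q\<close> vertices and \<open>m\<close> has at most
    \<open>n + 1\<close> of them; so the natural-number difference \<open>g - q\<close> is not
    truncated.\<close>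
  then have "q \<le> g" using M(3) card_vertices_le[OF m] unfolding has_genus_def by linarith
  let ?S = "insert (vertex_of m b) (set us)"
  have "has_genus n (g - q) m" using M(3) card \<open>q \<le> g\<close> unfolding has_genus_def by (simp add: of_nat_diff)
  moreover have "?S \<subseteq> vertices m"
    using us(1) vertex_in_vertices[OF gluable_half_edge[OF us(1)]] by (simp add: gluable_def)
  moreover have "card ?S = 2 * g - 2 * (g - q) + 1"
    using gluable_sorted_vertices(2)[OF us(1)] q \<open>q \<le> g\<close> by simp
  ultimately have "(m, ?S) \<in> U_rep (2 * g - 2 * (g - q) + 1) (g - q) n" using m by (simp add: U_rep_def)
  moreover have "Lambda_rep (m, ?S) = y"
    using Lambda_rep_eq_glue_pairs[OF us(1,3) q \<open>q \<ge> 1\<close>] us(4) \<tau> M(1) by simp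
  moreover have "g - q < g" using \<open>q \<ge> 1\<close> \<open>q \<le> g\<close> by simp
  ultimately show ?thesis using that by blast
qed

text \<open>All members of a class have equivalent images, so the union in \<open>Lambda\<close> is
  over copies of a single class.\<close>

lemma Lambda_class:
  assumes k: "k \<ge> 1" and x: "x \<in> U_rep (2 * k + 1) p n"
  shows "Lambda n (U_iso n `` {x}) = D_iso n `` {Lambda_rep x}"
proof -
  have "x \<in> U_iso n `` {x}"
    using equiv_class_self[OF equiv_U_iso] x by (auto simp: U_rep_def)
  moreover have "D_iso n `` {Lambda_rep y} = D_iso n `` {Lambda_rep x}" if "y \<in> U_iso n `` {x}" for y
    using equiv_class_eq[OF equiv_D_iso Lambda_rep_iso[OF k x]] that by blast
  ultimately show ?thesis unfolding Lambda_def by blast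
qed

text \<open>The first conjunct is what makes \<open>Lambda\<close> the lift of
  \<open>Lambda_rep\<close> to classes. \<open>SIGMA\<close> encodes the disjoint union, so
  injectivity also has to separate different \<open>p\<close>.\<close>

theorem theorem1:
  fixes g n :: nat
  assumes "g \<ge> 1" and "n \<ge> 1"
  shows "(\<forall>p\<in>{0..g-1}. \<forall>x \<in> (U_rep (2*g - 2*p + 1) p n :: ('h rooted_map \<times> 'h set set) set).
            Lambda_rep x \<in> D_rep g n \<and>
            (\<forall>y. (x, y) \<in> U_iso n \<longrightarrow> (Lambda_rep x, Lambda_rep y) \<in> D_iso n)) \<and>
         bij_betw (\<lambda>(p, X). Lambda n X)
           (SIGMA p:{0..g-1}. (U (2*g - 2*p + 1) p n :: ('h rooted_map \<times> 'h set set) set set))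
           (D g n)"
proof (intro conjI ballI allI impI)
  have k: "2*g - 2*p + 1 = 2 * (g - p) + 1" "g - p \<ge> 1" if "p \<in> {0..g-1}" for p
    using that assms(1) by auto
  show "Lambda_rep x \<in> D_rep g n" if "p \<in> {0..g-1}" "x \<in> U_rep (2*g - 2*p + 1) p n"
    for p and x :: "'h rooted_map \<times> 'h set set"
    using Lambda_rep_in_D_rep[OF _ assms(1) that(2)] that(1) by simp
  show "(Lambda_rep x, Lambda_rep y) \<in> D_iso n"
    if "p \<in> {0..g-1}" "x \<in> U_rep (2*g - 2*p + 1) p n" "(x, y) \<in> U_iso n"
    for p and x y :: "'h rooted_map \<times> 'h set set"
    using Lambda_rep_iso[OF k(2)[OF that(1)] that(2)[unfolded k(1)[OF that(1)]] that(3)] .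
  have cls: "Lambda n (U_iso n `` {x}) = D_iso n `` {Lambda_rep x}"
    if "p \<in> {0..g-1}" "x \<in> U_rep (2*g - 2*p + 1) p n"
    for p and x :: "'h rooted_map \<times> 'h set set"
    using Lambda_class[OF k(2)[OF that(1)] that(2)[unfolded k(1)[OF that(1)]]] .
  let ?A = "SIGMA p:{0..g-1}. (U (2*g - 2*p + 1) p n :: ('h rooted_map \<times> 'h set set) set set)"
  have inj: "inj_on (\<lambda>(p, X). Lambda n X) ?A"
  proof (rule inj_onI)
    fix s t assume st: "s \<in> ?A" "t \<in> ?A" "(\<lambda>(p, X). Lambda n X) s = (\<lambda>(p, X). Lambda n X) t"
    obtain p x where s: "s = (p, U_iso n `` {x})" "p \<in> {0..g-1}" "x \<in> U_rep (2*g - 2*p + 1) p n"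
      using st(1) by (auto simp: U_def quotient_def)
    obtain p' y where t: "t = (p', U_iso n `` {y})" "p' \<in> {0..g-1}" "y \<in> U_rep (2*g - 2*p' + 1) p' n"
      using st(2) by (auto simp: U_def quotient_def)
    have "D_iso n `` {Lambda_rep x} = D_iso n `` {Lambda_rep y}"
      using st(3) cls[OF s(2,3)] cls[OF t(2,3)] s(1) t(1) by simp
    moreover have "Lambda_rep y \<in> {(m, \<tau>). unicellular n m \<and> \<tau> \<in> half_edges m}"
      using Lambda_rep_in_D_rep[OF _ assms(1) t(3)] t(2) by (auto simp: D_rep_def trisection_def)
    ultimately have "(Lambda_rep x, Lambda_rep y) \<in> D_iso n"
      by (rule eq_equiv_class[OF _ equiv_D_iso])
    note R = Lambda_rep_iso_reflects[OF k(2)[OF s(2)] s(3)[unfolded k(1)[OF s(2)]]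
        k(2)[OF t(2)] t(3)[unfolded k(1)[OF t(2)]] this]
    \<comment> \<open>\<open>g - p\<close> determines \<open>p\<close> despite truncated
      subtraction, because \<open>p\<close> and \<open>p'\<close> are below
      \<open>g\<close>.\<close>
    have "p = p'" using R(1) s(2) t(2) assms(1) by auto
    moreover have "U_iso n `` {x} = U_iso n `` {y}" using equiv_class_eq[OF equiv_U_iso R(2)] .
    ultimately show "s = t" using s(1) t(1) by simp
  qed
  have img: "(\<lambda>(p, X). Lambda n X) ` ?A = D g n"
  proof (intro set_eqI iffI)
    fix Y assume "Y \<in> (\<lambda>(p, X). Lambda n X) ` ?A"
    then obtain p x where px: "p \<in> {0..g-1}" "x \<in> U_rep (2*g - 2*p + 1) p n"
      "Y = Lambda n (U_iso n `` {x :: 'h rooted_map \<times> 'h set set})"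
      by (auto simp: U_def quotient_def)
    then show "Y \<in> D g n"
      using cls[OF px(1,2)] Lambda_rep_in_D_rep[OF _ assms(1) px(2)] by (auto simp: D_def quotientI)
  next
    fix Y assume "Y \<in> (D g n :: ('h rooted_map \<times> 'h) set set)"
    then obtain y where y: "y \<in> D_rep g n" "Y = D_iso n `` {y}" by (auto simp: D_def quotient_def)
    obtain p x where x: "p < g" "x \<in> U_rep (2*g - 2*p + 1) p n" "Lambda_rep x = y"
      using Lambda_rep_surj[OF y(1)] by blast
    have p: "p \<in> {0..g-1}" using x(1) by simp
    have "Y = (\<lambda>(p, X). Lambda n X) (p, U_iso n `` {x})" using cls[OF p x(2)] x(3) y(2) by simp
    moreover have "(p, U_iso n `` {x}) \<in> ?A" using p x(2) by (auto simp: U_def quotientI)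
    ultimately show "Y \<in> (\<lambda>(p, X). Lambda n X) ` ?A" by (rule image_eqI)
  qed
  show "bij_betw (\<lambda>(p, X). Lambda n X) ?A (D g n)" using inj img by (rule bij_betw_imageI)
qed

end
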